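(* Let $\Omega\subset\mathbb{R}^d$ be compact and convex with non-negligible interior, let $\mu,\nu\in\mathcal{P}(\Omega)$ with $\mu\ll\mathcal{L}_d$, and let $\lambda>0$. Let $\rho_\lambda$ be the unique minimizer over $\rho\in\mathcal{P}(\Omega)$ of $\frac12W_2^2(\mu,\rho)+\lambda W_1(\rho,\nu)$, and let $T_\lambda$ be the optimal transport map for $W_2(\mu,\rho_\lambda)$, which by definition satisfies $(T_\lambda)_\#\mu=\rho_\lambda$. If $\nu\notin B_\lambda(\mu)$, let $\varphi_\lambda$ be a Kantorovich potential for $W_2(\mu,\rho_\lambda)$ satisfying $\mathrm{Lip}(\varphi_\lambda)=\lambda$ and $\int_\Omega\varphi_\lambda(d\nu-d\rho_\lambda)=\lambda W_1(\rho_\lambda,\nu)$ (such a potential exists in this case). Then, for this $\varphi_\lambda$ (items 1 and 2) and for $T_\lambda$: 1. $\varphi_\lambda$ is a solution to $$\sup_{\varphi\in C(\Omega)}\int_\Omega\varphi^{c_{2,\lambda}}\,d\mu+\int_\Omega\varphi\,d\nu,$$ where $\varphi^{c_{2,\lambda}}(x)=\inf_{y\in\Omega}\big(c_{2,\lambda}(x,y)-\varphi(y)\big)$. 2. $T_\lambda$ is the solution map $x_0\mapsto T_\lambda(x_0)$ to the problem $$\inf_{x\in\Omega}\ \frac12|x-x_0|^2-\varphi_\lambda(x).$$ 3. If $\gamma_0$ is an optimal transport plan for transporting $\mu$ to $\nu$ under the cost $c_{2,\lambda}$, and if $(x,y)\in\mathrm{spt}(\gamma_0)$, then $$T_\lambda(x)=\begin{cases}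 y & |x-y|\le\lambda,\\ \Big(1-\frac{\lambda}{|x-y|}\Big)x+\frac{\lambda}{|x-y|}\,y & |x-y|>\lambda.\end{cases}$$
   Context: $\mathcal{P}(\Omega)$ is the set of Borel probability measures on $\Omega$, $\mathcal{L}_d$ is Lebesgue measure on $\mathbb{R}^d$, $W_p$ is the Wasserstein $p$ distance for the Euclidean distance, $T_\#\mu$ is the pushforward of $\mu$ by $T$, $\mathrm{spt}$ denotes support, and $\mathrm{Lip}(\varphi)$ is the Lipschitz constant of $\varphi$ on $\Omega$. Let $c_2(x,y)=\frac12|x-y|^2$. The Huber cost is $c_{2,\lambda}(x,y)=\frac12|x-y|^2$ if $|x-y|\le\lambda$ and $c_{2,\lambda}(x,y)=\lambda|x-y|-\frac{\lambda^2}{2}$ if $|x-y|\ge\lambda$. The set $B_\lambda(\mu)$ consists of all $\rho\in\mathcal{P}(\Omega)$ for which there is a plan $\gamma$ with marginals $\mu$ and $\rho$ that is optimal for transporting $\mu$ to $\rho$ under the cost $c_{2,\lambda}$ and satisfies $\mathrm{spt}(\gamma)\subset\{(x,y):|x-y|\le\lambda\}$. A function $\varphi\in C(\Omega)$ is here called a Kantorovich potential for $W_2(\mu,\rho)$ if $\int_\Omega\varphi^{c_2}\,d\mu+\int_\Omega\varphi\,d\rho=\frac12W_2^2(\mu,\rho)$, where $\varphi^{c_2}(x)=\inf_{y\in\Omega}\big(c_2(x,y)-\varphi(y)\big)$. As usual for optimal transport maps, $T_\lambda$ is unique up to $\mu$-null sets. *)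

theory Defs
  imports "HOL-Probability.Probability"
begin

text \<open>
  Measures on \<open>\<Omega>\<close> live on the trace of the Borel sigma-algebra, so \<open>\<integral>x. f x \<partial>\<mu>\<close> is an
  integral over \<open>\<Omega>\<close> and values of functions outside \<open>\<Omega>\<close> are irrelevant.
\<close>

definition borel_probs :: "'a::topological_space set \<Rightarrow> 'a measure set" where
  "borel_probs \<Omega> = space (prob_algebra (restrict_space borel \<Omega>))"

definition spt :: "'a::topological_space measure \<Rightarrow> 'a set" where
  "spt M = {x \<in> space M. \<forall>U. open U \<longrightarrow> x \<in> U \<longrightarrow> emeasure M (U \<inter> space M) > 0}"

definition plans :: "'a measure \<Rightarrow> 'b measure \<Rightarrow> ('a \<times> 'b) measure set" where
  "plans \<mu> \<nu> = {\<gamma> \<in> space (prob_algebra (\<mu> \<Otimes>\<^sub>M \<nu>)). distr \<gamma> \<mu> fst = \<mu> \<and> distr \<gamma> \<nu> snd = \<nu>}"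

text \<open>
  Real-valued Bochner integral: adequate here because all costs below are continuous, hence
  bounded on the compact set \<open>\<Omega> \<times> \<Omega>\<close>.
\<close>

definition transport_cost :: "('a \<Rightarrow> 'b \<Rightarrow> real) \<Rightarrow> ('a \<times> 'b) measure \<Rightarrow> real" where
  "transport_cost c \<gamma> = (\<integral>z. c (fst z) (snd z) \<partial>\<gamma>)"

definition optimal_plan ::
  "('a \<Rightarrow> 'b \<Rightarrow> real) \<Rightarrow> 'a measure \<Rightarrow> 'b measure \<Rightarrow> ('a \<times> 'b) measure \<Rightarrow> bool" where
  "optimal_plan c \<mu> \<nu> \<gamma> \<longleftrightarrow> is_arg_min (transport_cost c) (\<lambda>\<gamma>. \<gamma> \<in> plans \<mu> \<nu>) \<gamma>"

definition optimal_map ::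
  "('a \<Rightarrow> 'b \<Rightarrow> real) \<Rightarrow> 'a measure \<Rightarrow> 'b measure \<Rightarrow> ('a \<Rightarrow> 'b) \<Rightarrow> bool" where
  "optimal_map c \<mu> \<nu> T \<longleftrightarrow> T \<in> \<mu> \<rightarrow>\<^sub>M \<nu> \<and> distr \<mu> \<nu> T = \<nu> \<and>
     optimal_plan c \<mu> \<nu> (distr \<mu> (\<mu> \<Otimes>\<^sub>M \<nu>) (\<lambda>x. (x, T x)))"

definition wasserstein :: "real \<Rightarrow> 'a::metric_space measure \<Rightarrow> 'a measure \<Rightarrow> real" where
  "wasserstein p \<mu> \<nu> =
     (INF \<gamma>\<in>plans \<mu> \<nu>. transport_cost (\<lambda>x y. dist x y powr p) \<gamma>) powr (1 / p)"

definition cost2 :: "'a::real_normed_vector \<Rightarrow> 'a \<Rightarrow> real" where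
  "cost2 x y = 1/2 * (norm (x - y))\<^sup>2"

definition huber_cost :: "real \<Rightarrow> 'a::real_normed_vector \<Rightarrow> 'a \<Rightarrow> real" where
  "huber_cost lam x y =
     (if norm (x - y) \<le> lam then 1/2 * (norm (x - y))\<^sup>2 else lam * norm (x - y) - lam\<^sup>2 / 2)"

definition huber_ball ::
  "'a::real_normed_vector set \<Rightarrow> real \<Rightarrow> 'a measure \<Rightarrow> 'a measure set" where
  "huber_ball \<Omega> lam \<mu> = {\<rho> \<in> borel_probs \<Omega>.
     \<exists>\<gamma>. optimal_plan (huber_cost lam) \<mu> \<rho> \<gamma> \<and> spt \<gamma> \<subseteq> {(x, y). norm (x - y) \<le> lam}}"

definition c_transform :: "'a set \<Rightarrow> ('a \<Rightarrow> 'a \<Rightarrow> real) \<Rightarrow> ('a \<Rightarrow> real) \<Rightarrow> 'a \<Rightarrow> real" where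
  "c_transform \<Omega> c \<phi> x = (INF y\<in>\<Omega>. c x y - \<phi> y)"

definition dual_value ::
  "'a set \<Rightarrow> ('a \<Rightarrow> 'a \<Rightarrow> real) \<Rightarrow> 'a measure \<Rightarrow> 'a measure \<Rightarrow> ('a \<Rightarrow> real) \<Rightarrow> real" where
  "dual_value \<Omega> c \<mu> \<nu> \<phi> = (\<integral>x. c_transform \<Omega> c \<phi> x \<partial>\<mu>) + (\<integral>y. \<phi> y \<partial>\<nu>)"

definition kantorovich_potential_W2 ::
  "'a::real_normed_vector set \<Rightarrow> 'a measure \<Rightarrow> 'a measure \<Rightarrow> ('a \<Rightarrow> real) \<Rightarrow> bool" where
  "kantorovich_potential_W2 \<Omega> \<mu> \<rho> \<phi> \<longleftrightarrow>
     continuous_on \<Omega> \<phi> \<and> dual_value \<Omega> cost2 \<mu> \<rho> \<phi> = 1/2 * (wasserstein 2 \<mu> \<rho>)\<^sup>2"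

text \<open>The Lipschitz constant on \<open>\<Omega>\<close>; it is \<open>\<infinity>\<close> for functions that are not Lipschitz.\<close>

definition lip_const :: "'a::metric_space set \<Rightarrow> ('a \<Rightarrow> real) \<Rightarrow> ereal" where
  "lip_const \<Omega> \<phi> = (INF C\<in>{C. C-lipschitz_on \<Omega> \<phi>}. ereal C)"

end

theory Submission
  imports Defs
begin

text \<open>
  Write \<open>d(x, y) = lam * \<bar>x - y\<bar>\<close>. The Huber cost is the infimal convolution of \<open>cost2\<close> with \<open>d\<close>:
  it is the least price of going from \<open>x\<close> to some \<open>z\<close> at cost \<open>cost2\<close> and on from \<open>z\<close> to \<open>y\<close> at
  cost \<open>d\<close> (\<open>huber_cost_le_split\<close>), and the best intermediate point is \<open>huber_step lam x y\<close>, the point of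
  the segment at distance at most \<open>lam\<close> from \<open>x\<close> that is closest to \<open>y\<close> (\<open>huber_cost_eq_split\<close>).
  The regularized problem, minimize \<open>1/2 * W\<^sub>2\<^sup>2(\<mu>, \<sigma>) + lam * W\<^sub>1(\<sigma>, \<nu>)\<close> over \<open>\<sigma>\<close>, is therefore Huber
  transport from \<open>\<mu>\<close> to \<open>\<nu>\<close> with an intermediate stop at \<open>\<sigma>\<close>.

  Optimality of the potential. Given any \<open>\<psi>\<close>, its \<open>d\<close>-transform \<open>g\<close> separates the Huber dual
  functional at \<open>\<psi>\<close> into a quadratic dual functional at \<open>-g\<close> and a \<open>d\<close>-dual functional at \<open>\<psi>\<close>; weak
  duality for both bounds it by the value of the regularized problem at any \<open>\<rho>\<close>
  (\<open>dual_huber_le\<close>). A \<open>lam\<close>-Lipschitz \<open>\<phi>\<close> gains nothing from the second leg, so its Huber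
  transform dominates its quadratic transform. As \<open>\<phi>\<close> is optimal for the quadratic problem between \<open>\<mu>\<close> and \<open>\<rho>\<close>
  and for the \<open>d\<close>-problem between \<open>\<rho>\<close> and \<open>\<nu>\<close>, it attains the bound.

  The map. The graph of \<open>T\<close> has zero duality gap with \<open>\<phi>\<close>, so \<open>T x\<close> minimizes \<open>cost2 x y - \<phi> y\<close> over
  \<open>y\<close> for almost every \<open>x\<close>. The minimizer is unique for Lebesgue almost every \<open>x\<close>: minimizers are monotone
  in \<open>x\<close>, so on each line parallel to a coordinate axis that coordinate of the minimizer is ambiguous only
  countably often (\<open>minimizers_cost2_unique_AE\<close>). Absolute continuity transfers this to \<open>\<mu>\<close>.

  The formula for \<open>T\<close>. An optimal Huber plan \<open>\<gamma>\<close> has cyclically monotone support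
  (\<open>spt_optimal_plan_cyclically_monotone\<close>), and Rockafellar's chain construction turns this into a
  \<open>lam\<close>-Lipschitz \<open>\<phi>\<close> such that \<open>y\<close> minimizes \<open>huber_cost lam x y - \<phi> y\<close> whenever \<open>(x, y)\<close> lies in the
  support (\<open>cyclically_monotone_potential\<close>). Stopping \<open>\<gamma>\<close> at \<open>huber_step\<close> gives a competitor for \<open>\<rho>\<close>,
  so all inequalities between the two problems are equalities and \<open>\<phi>\<close> is also a quadratic potential for
  \<open>\<rho>\<close> (\<open>huber_potential_optimal_for_minimizer\<close>). Since \<open>\<phi>\<close> is \<open>lam\<close>-Lipschitz, \<open>huber_step lam x y\<close>
  minimizes \<open>cost2 x z - \<phi> z\<close> over \<open>z\<close> (\<open>huber_step_minimizer\<close>), and so does \<open>T x\<close>;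
  uniqueness of the minimizer makes them equal.
\<close>

section \<open>Measures and plans on a subset\<close>

lemma borel_probsD:
  assumes "\<mu> \<in> borel_probs \<Omega>"
  shows "prob_space \<mu>" "sets \<mu> = sets (restrict_space borel \<Omega>)" "space \<mu> = \<Omega>"
  using assms sets_eq_imp_space_eq[of \<mu> "restrict_space borel \<Omega>"]
  by (auto simp: borel_probs_def space_prob_algebra space_restrict_space)

lemma borel_probsI:
  assumes "prob_space \<mu>" "sets \<mu> = sets (restrict_space borel \<Omega>)"
  shows "\<mu> \<in> borel_probs \<Omega>"
  using assms by (auto simp: borel_probs_def space_prob_algebra)

lemma measurable_continuous_on_borel_probs:
  fixes f :: "'a::topological_space \<Rightarrow> 'b::topological_space"
  assumes "\<mu> \<in> borel_probs \<Omega>" "continuous_on \<Omega> f"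
  shows "f \<in> \<mu> \<rightarrow>\<^sub>M borel"
  using borel_measurable_continuous_on_restrict[OF assms(2)]
    measurable_cong_sets[OF borel_probsD(2)[OF assms(1)] refl] by blast

lemma integrable_continuous_on_borel_probs:
  fixes f :: "'a::topological_space \<Rightarrow> real"
  assumes "\<mu> \<in> borel_probs \<Omega>" "compact \<Omega>" "continuous_on \<Omega> f"
  shows "integrable \<mu> f"
proof -
  interpret prob_space \<mu> using borel_probsD assms by blast
  obtain B where "\<And>x. x \<in> \<Omega> \<Longrightarrow> norm (f x) \<le> B"
    using compact_imp_bounded[OF compact_continuous_image[OF assms(3,2)]]
    unfolding bounded_iff by auto
  then show ?thesis
    using measurable_continuous_on_borel_probs[OF assms(1,3)] borel_probsD(3)[OF assms(1)]
    by (intro integrable_const_bound[of _ B]) auto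
qed

text \<open>
  Second countability makes the product of the two trace sigma-algebras a trace sigma-algebra again.
  Hence a plan between measures on \<open>\<Omega>\<close> is itself a Borel probability on \<open>\<Omega> \<times> \<Omega>\<close>, and every fact about
  \<open>borel_probs\<close> also applies to plans.
\<close>

lemma sets_pair_restrict_space_borel:
  fixes A :: "'a::second_countable_topology set" and B :: "'b::second_countable_topology set"
  shows "sets (restrict_space borel A \<Otimes>\<^sub>M restrict_space borel B) = sets (restrict_space borel (A \<times> B))"
  (is "sets ?P = sets ?R")
proof -
  have sp: "space ?P = A \<times> B" "space ?R = A \<times> B"
    by (auto simp: space_pair_measure space_restrict_space)
  have 1: "(\<lambda>z. z) \<in> ?P \<rightarrow>\<^sub>M ?R"
  proof (rule measurable_restrict_space2)
    show "(\<lambda>z. z) \<in> space ?P \<rightarrow> A \<times> B" by (auto simp: sp)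
    have "(\<lambda>z. (fst z, snd z)) \<in> ?P \<rightarrow>\<^sub>M borel \<Otimes>\<^sub>M borel"
      by (intro measurable_Pair measurable_compose[OF measurable_fst] measurable_compose[OF measurable_snd]
         measurable_restrict_space1 measurable_ident_sets[OF refl])
    then show "(\<lambda>z. z) \<in> ?P \<rightarrow>\<^sub>M borel" by (simp add: borel_prod)
  qed
  have 2: "(\<lambda>z. z) \<in> ?R \<rightarrow>\<^sub>M ?P"
  proof -
    have "(\<lambda>z. (fst z, snd z)) \<in> ?R \<rightarrow>\<^sub>M ?P"
      by (intro measurable_Pair measurable_restrict_space2 borel_measurable_continuous_on_restrict
            continuous_intros) (auto simp: sp)
    then show ?thesis by simp
  qed
  show ?thesis
  proof (intro equalityI subsetI)
    fix X assume X: "X \<in> sets ?P"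
    then have "X \<subseteq> A \<times> B" using sets.sets_into_space[OF X] sp by auto
    with measurable_sets[OF 2 X] show "X \<in> sets ?R" by (simp add: sp Int_absorb2)
  next
    fix X assume X: "X \<in> sets ?R"
    then have "X \<subseteq> A \<times> B" using sets.sets_into_space[OF X] sp by auto
    with measurable_sets[OF 1 X] show "X \<in> sets ?P" by (simp add: sp Int_absorb2)
  qed
qed

lemma plansD:
  assumes "\<gamma> \<in> plans \<mu> \<nu>"
  shows "prob_space \<gamma>" "sets \<gamma> = sets (\<mu> \<Otimes>\<^sub>M \<nu>)" "space \<gamma> = space \<mu> \<times> space \<nu>"
    "distr \<gamma> \<mu> fst = \<mu>" "distr \<gamma> \<nu> snd = \<nu>" "fst \<in> \<gamma> \<rightarrow>\<^sub>M \<mu>" "snd \<in> \<gamma> \<rightarrow>\<^sub>M \<nu>"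
proof -
  show a: "prob_space \<gamma>" "sets \<gamma> = sets (\<mu> \<Otimes>\<^sub>M \<nu>)" "distr \<gamma> \<mu> fst = \<mu>" "distr \<gamma> \<nu> snd = \<nu>"
    using assms by (auto simp: plans_def space_prob_algebra)
  show "space \<gamma> = space \<mu> \<times> space \<nu>" "fst \<in> \<gamma> \<rightarrow>\<^sub>M \<mu>" "snd \<in> \<gamma> \<rightarrow>\<^sub>M \<nu>"
    using sets_eq_imp_space_eq[OF a(2)] by (simp_all add: space_pair_measure measurable_cong_sets[OF a(2) refl])
qed

lemma plans_borel_probs:
  fixes \<mu> \<nu> :: "'a::second_countable_topology measure"
  assumes "\<mu> \<in> borel_probs \<Omega>" "\<nu> \<in> borel_probs \<Omega>" "\<gamma> \<in> plans \<mu> \<nu>"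
  shows "\<gamma> \<in> borel_probs (\<Omega> \<times> \<Omega>)"
proof (rule borel_probsI)
  show "sets \<gamma> = sets (restrict_space borel (\<Omega> \<times> \<Omega>))"
    using plansD(2)[OF assms(3)] sets_pair_measure_cong[OF borel_probsD(2)[OF assms(1)] borel_probsD(2)[OF assms(2)]]
    by (simp add: sets_pair_restrict_space_borel)
qed (rule plansD(1)[OF assms(3)])

lemma plan_from_coupling:
  assumes "prob_space P" "X \<in> P \<rightarrow>\<^sub>M \<mu>" "Y \<in> P \<rightarrow>\<^sub>M \<nu>" "distr P \<mu> X = \<mu>" "distr P \<nu> Y = \<nu>"
  shows "distr P (\<mu> \<Otimes>\<^sub>M \<nu>) (\<lambda>p. (X p, Y p)) \<in> plans \<mu> \<nu>"
proof -
  have [measurable]: "X \<in> P \<rightarrow>\<^sub>M \<mu>" "Y \<in> P \<rightarrow>\<^sub>M \<nu>" by fact+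
  show ?thesis
    using assms by (auto simp: plans_def space_prob_algebra distr_distr comp_def
        intro!: prob_space.prob_space_distr)
qed

lemma product_in_plans:
  assumes "prob_space \<mu>" "prob_space \<nu>"
  shows "\<mu> \<Otimes>\<^sub>M \<nu> \<in> plans \<mu> \<nu>"
proof -
  interpret pair_prob_space \<mu> \<nu> using assms by (simp add: pair_prob_space_def pair_sigma_finite_def prob_space_imp_sigma_finite)
  have "distr (\<mu> \<Otimes>\<^sub>M \<nu>) \<nu> snd = \<nu>"
    by (rule measure_eqI) (auto simp: emeasure_distr M2.emeasure_pair_measure_Times M1.emeasure_space_1 space_pair_measure Times_Int_Times
      sets.sets_into_space Int_absorb2 snd_vimage_eq_Times sets.Int_space_eq2)
  then show ?thesis
    by (auto simp: plans_def space_prob_algebra M2.distr_pair_fst intro: P.prob_space_axioms)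
qed

lemma integral_plan_marginals:
  fixes f g :: "_ \<Rightarrow> real"
  assumes "\<gamma> \<in> plans \<mu> \<nu>"
  shows "integrable \<mu> f \<Longrightarrow> integrable \<gamma> (\<lambda>z. f (fst z))"
    "integrable \<nu> g \<Longrightarrow> integrable \<gamma> (\<lambda>z. g (snd z))"
    "integrable \<mu> f \<Longrightarrow> (\<integral>z. f (fst z) \<partial>\<gamma>) = (\<integral>x. f x \<partial>\<mu>)"
    "integrable \<nu> g \<Longrightarrow> (\<integral>z. g (snd z) \<partial>\<gamma>) = (\<integral>y. g y \<partial>\<nu>)"
  using plansD[OF assms] integrable_distr_eq[of fst \<gamma> \<mu> f] integrable_distr_eq[of snd \<gamma> \<nu> g]
    integral_distr[of fst \<gamma> \<mu> f] integral_distr[of snd \<gamma> \<nu> g] by auto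

section \<open>Minimal costs and weak duality\<close>

definition min_cost :: "('a \<Rightarrow> 'b \<Rightarrow> real) \<Rightarrow> 'a measure \<Rightarrow> 'b measure \<Rightarrow> real" where
  "min_cost c \<mu> \<nu> = (INF \<gamma>\<in>plans \<mu> \<nu>. transport_cost c \<gamma>)"

lemma transport_cost_nonneg: "(\<And>x y. c x y \<ge> 0) \<Longrightarrow> transport_cost c \<gamma> \<ge> 0"
  by (auto simp: transport_cost_def)

lemma min_cost_le:
  assumes "\<And>x y. c x y \<ge> 0" "\<gamma> \<in> plans \<mu> \<nu>"
  shows "min_cost c \<mu> \<nu> \<le> transport_cost c \<gamma>"
  unfolding min_cost_def by (intro cINF_lower assms bdd_belowI2[of _ 0] transport_cost_nonneg)

lemma min_cost_nonneg:
  assumes "\<And>x y. c x y \<ge> 0" "prob_space \<mu>" "prob_space \<nu>"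
  shows "min_cost c \<mu> \<nu> \<ge> 0"
  unfolding min_cost_def using product_in_plans[OF assms(2,3)]
  by (intro cINF_greatest transport_cost_nonneg assms) auto

lemma min_cost_scale:
  assumes "\<And>x y. c x y \<ge> 0" "prob_space \<mu>" "prob_space \<nu>" "k > 0"
  shows "min_cost (\<lambda>x y. k * c x y) \<mu> \<nu> = k * min_cost c \<mu> \<nu>"
proof (rule antisym)
  note ne = product_in_plans[OF assms(2,3)]
  have t: "transport_cost (\<lambda>x y. k * c x y) \<gamma> = k * transport_cost c \<gamma>" for \<gamma>
    by (simp add: transport_cost_def)
  have nn: "0 \<le> k * c x y" for x y using assms by simp
  have "min_cost (\<lambda>x y. k * c x y) \<mu> \<nu> / k \<le> min_cost c \<mu> \<nu>"
    unfolding min_cost_def[of c] using ne min_cost_le[where c="\<lambda>x y. k * c x y", OF nn] assms(4)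
    by (intro cINF_greatest) (auto simp: t field_simps)
  then show "min_cost (\<lambda>x y. k * c x y) \<mu> \<nu> \<le> k * min_cost c \<mu> \<nu>" using assms(4) by (simp add: field_simps)
  show "k * min_cost c \<mu> \<nu> \<le> min_cost (\<lambda>x y. k * c x y) \<mu> \<nu>"
    unfolding min_cost_def[of "\<lambda>x y. k * c x y"] using ne min_cost_le[where c=c, OF assms(1)] assms(4)
    by (intro cINF_greatest) (auto simp: t)
qed

lemma wasserstein_2_min_cost:
  assumes "prob_space \<mu>" "prob_space \<nu>"
  shows "1/2 * (wasserstein 2 \<mu> \<nu>)\<^sup>2 = min_cost cost2 \<mu> \<nu>"
proof -
  have d: "(\<lambda>x y::'a. dist x y powr 2) = (\<lambda>x y. (dist x y)\<^sup>2)"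
    by (intro ext) (simp add: powr_numeral)
  have "wasserstein 2 \<mu> \<nu> = sqrt (min_cost (\<lambda>x y. (dist x y)\<^sup>2) \<mu> \<nu>)"
    unfolding wasserstein_def d min_cost_def[symmetric]
    by (simp add: powr_half_sqrt min_cost_nonneg assms)
  moreover have "min_cost cost2 \<mu> \<nu> = 1/2 * min_cost (\<lambda>x y. (dist x y)\<^sup>2) \<mu> \<nu>"
    using min_cost_scale[of "\<lambda>x y. (dist x y)\<^sup>2" \<mu> \<nu> "1/2"] assms
    by (simp add: cost2_def[abs_def] dist_norm)
  ultimately show ?thesis by (simp add: min_cost_nonneg assms)
qed

lemma wasserstein_1_min_cost:
  assumes "prob_space \<mu>" "prob_space \<nu>" "k > 0"
  shows "k * wasserstein 1 \<mu> \<nu> = min_cost (\<lambda>x y. k * dist x y) \<mu> \<nu>"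
  using min_cost_scale[of dist \<mu> \<nu> k] min_cost_nonneg[of dist \<mu> \<nu>] assms
  by (simp add: wasserstein_def min_cost_def)

lemma optimal_plan_min_cost:
  assumes "\<And>x y. c x y \<ge> 0" "optimal_plan c \<mu> \<nu> \<gamma>"
  shows "\<gamma> \<in> plans \<mu> \<nu>" "transport_cost c \<gamma> = min_cost c \<mu> \<nu>"
proof -
  show g: "\<gamma> \<in> plans \<mu> \<nu>" using assms(2) by (simp add: optimal_plan_def is_arg_min_def)
  have "transport_cost c \<gamma> \<le> min_cost c \<mu> \<nu>" unfolding min_cost_def
    using assms(2) g by (intro cINF_greatest) (auto simp: optimal_plan_def is_arg_min_linorder)
  with min_cost_le[where c=c, OF assms(1) g] show "transport_cost c \<gamma> = min_cost c \<mu> \<nu>" by simp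
qed

lemma c_transform_le:
  fixes c :: "'a::topological_space \<Rightarrow> 'a \<Rightarrow> real"
  assumes "compact \<Omega>" "continuous_on (\<Omega> \<times> \<Omega>) (\<lambda>(x, y). c x y)" "continuous_on \<Omega> \<phi>" "x \<in> \<Omega>" "y \<in> \<Omega>"
  shows "c_transform \<Omega> c \<phi> x \<le> c x y - \<phi> y"
proof -
  have "continuous_on \<Omega> (\<lambda>y. (\<lambda>(x, y). c x y) (x, y))"
    by (rule continuous_on_compose2[OF assms(2)]) (use assms in \<open>auto intro!: continuous_intros\<close>)
  then have "continuous_on \<Omega> (\<lambda>y. c x y - \<phi> y)" using assms by (auto intro!: continuous_intros)
  then have "bdd_below ((\<lambda>y. c x y - \<phi> y) ` \<Omega>)"
    by (intro bounded_imp_bdd_below compact_imp_bounded compact_continuous_image assms)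
  then show ?thesis unfolding c_transform_def using assms by (intro cINF_lower)
qed

lemma c_transform_ge:
  assumes "\<Omega> \<noteq> {}" "\<And>y. y \<in> \<Omega> \<Longrightarrow> m \<le> c x y - \<phi> y"
  shows "m \<le> c_transform \<Omega> c \<phi> x"
  unfolding c_transform_def using assms by (intro cINF_greatest)

text \<open>
  Uniform continuity of \<open>c\<close> on the compact square gives the functions \<open>\<lambda>x. c x y - \<phi> y\<close> a modulus of
  continuity that does not depend on \<open>y\<close>, and an infimum inherits a common modulus.
\<close>

lemma continuous_on_c_transform:
  fixes c :: "'a::metric_space \<Rightarrow> 'a \<Rightarrow> real"
  assumes "compact \<Omega>" "continuous_on (\<Omega> \<times> \<Omega>) (\<lambda>(x, y). c x y)" "continuous_on \<Omega> \<phi>"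
  shows "continuous_on \<Omega> (c_transform \<Omega> c \<phi>)"
  unfolding continuous_on_iff
proof (intro ballI allI impI)
  fix x and e :: real assume x: "x \<in> \<Omega>" and e: "0 < e"
  have "uniformly_continuous_on (\<Omega> \<times> \<Omega>) (\<lambda>(x, y). c x y)"
    by (intro compact_uniformly_continuous assms compact_Times)
  then obtain d where d: "d > 0"
    "\<And>z z'. z \<in> \<Omega> \<times> \<Omega> \<Longrightarrow> z' \<in> \<Omega> \<times> \<Omega> \<Longrightarrow> dist z' z < d \<Longrightarrow> dist (case z' of (x, y) \<Rightarrow> c x y) (case z of (x, y) \<Rightarrow> c x y) < e/2"
    unfolding uniformly_continuous_on_def using half_gt_zero[OF e] by metis
  have ne: "\<Omega> \<noteq> {}" using x by auto
  have half: "c_transform \<Omega> c \<phi> u \<le> c_transform \<Omega> c \<phi> v + e/2" if "u \<in> \<Omega>" "v \<in> \<Omega>" "dist u v < d" for u v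
  proof -
    have "c_transform \<Omega> c \<phi> u - e/2 \<le> c_transform \<Omega> c \<phi> v"
    proof (rule c_transform_ge[OF ne])
      fix y assume y: "y \<in> \<Omega>"
      have "\<bar>c u y - c v y\<bar> < e/2"
        using d(2)[of "(v, y)" "(u, y)"] that y by (simp add: dist_Pair_Pair dist_real_def)
      with c_transform_le[OF assms that(1) y] show "c_transform \<Omega> c \<phi> u - e/2 \<le> c v y - \<phi> y" by linarith
    qed
    then show ?thesis by simp
  qed
  show "\<exists>d>0. \<forall>x'\<in>\<Omega>. dist x' x < d \<longrightarrow> dist (c_transform \<Omega> c \<phi> x') (c_transform \<Omega> c \<phi> x) < e"
  proof (intro exI[of _ d] conjI ballI impI d(1))
    fix x' assume "x' \<in> \<Omega>" "dist x' x < d"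
    with half[of x x'] half[of x' x] x e show "dist (c_transform \<Omega> c \<phi> x') (c_transform \<Omega> c \<phi> x) < e"
      by (simp add: dist_real_def dist_commute)
  qed
qed

text \<open>
  The superdifferential of the transform. For compact \<open>\<Omega>\<close>, continuous \<open>c\<close> and \<open>\<phi>\<close>, and \<open>x \<in> \<Omega>\<close>,
  a point \<open>y \<in> \<Omega>\<close> belongs to this set iff \<open>\<phi>\<close> and its \<open>c\<close>-transform satisfy the duality inequality at \<open>(x, y)\<close> with equality.
\<close>

definition minimizers :: "'a set \<Rightarrow> ('a \<Rightarrow> 'a \<Rightarrow> real) \<Rightarrow> ('a \<Rightarrow> real) \<Rightarrow> 'a \<Rightarrow> 'a set" where
  "minimizers \<Omega> c \<phi> x = {y \<in> \<Omega>. \<forall>y'\<in>\<Omega>. c x y - \<phi> y \<le> c x y' - \<phi> y'}"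

text \<open>
  The difference of the two values is the integral against \<open>\<gamma>\<close> of the pointwise duality gap, which is
  nonnegative; hence the values agree iff the gap vanishes almost everywhere.
\<close>

lemma weak_duality_plan:
  fixes \<mu> \<nu> :: "'a::euclidean_space measure"
  assumes \<Omega>: "compact \<Omega>" and \<mu>: "\<mu> \<in> borel_probs \<Omega>" and \<nu>: "\<nu> \<in> borel_probs \<Omega>"
    and c: "continuous_on (\<Omega> \<times> \<Omega>) (\<lambda>(x, y). c x y)" and \<phi>: "continuous_on \<Omega> \<phi>"
    and \<gamma>: "\<gamma> \<in> plans \<mu> \<nu>"
  shows "integrable \<gamma> (\<lambda>z. c (fst z) (snd z) - \<phi> (snd z) - c_transform \<Omega> c \<phi> (fst z))"
    and "transport_cost c \<gamma> - dual_value \<Omega> c \<mu> \<nu> \<phi> =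
      (\<integral>z. c (fst z) (snd z) - \<phi> (snd z) - c_transform \<Omega> c \<phi> (fst z) \<partial>\<gamma>)"
    and "dual_value \<Omega> c \<mu> \<nu> \<phi> \<le> transport_cost c \<gamma>"
proof -
  note \<gamma>p = plans_borel_probs[OF \<mu> \<nu> \<gamma>]
  have i1: "integrable \<gamma> (\<lambda>z. c (fst z) (snd z))"
    using integrable_continuous_on_borel_probs[OF \<gamma>p compact_Times[OF \<Omega> \<Omega>] c]
    by (simp add: case_prod_unfold)
  note i2 = integrable_continuous_on_borel_probs[OF \<nu> \<Omega> \<phi>]
  note i3 = integrable_continuous_on_borel_probs[OF \<mu> \<Omega> continuous_on_c_transform[OF \<Omega> c \<phi>]]
  note m = integral_plan_marginals[OF \<gamma>]
  show "integrable \<gamma> (\<lambda>z. c (fst z) (snd z) - \<phi> (snd z) - c_transform \<Omega> c \<phi> (fst z))"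
    using i1 m(2)[OF i2] m(1)[OF i3] by auto
  show eq: "transport_cost c \<gamma> - dual_value \<Omega> c \<mu> \<nu> \<phi> =
      (\<integral>z. c (fst z) (snd z) - \<phi> (snd z) - c_transform \<Omega> c \<phi> (fst z) \<partial>\<gamma>)"
    using i1 m(2)[OF i2] m(1)[OF i3] m(4)[OF i2] m(3)[OF i3]
    by (simp add: transport_cost_def dual_value_def)
  have "0 \<le> (\<integral>z. c (fst z) (snd z) - \<phi> (snd z) - c_transform \<Omega> c \<phi> (fst z) \<partial>\<gamma>)"
  proof (rule integral_nonneg_AE, rule AE_I2)
    fix z assume "z \<in> space \<gamma>"
    then have "fst z \<in> \<Omega>" "snd z \<in> \<Omega>" using borel_probsD(3)[OF \<gamma>p] by (simp_all add: mem_Times_iff)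
    from c_transform_le[OF \<Omega> c \<phi> this]
    show "0 \<le> c (fst z) (snd z) - \<phi> (snd z) - c_transform \<Omega> c \<phi> (fst z)" by simp
  qed
  with eq show "dual_value \<Omega> c \<mu> \<nu> \<phi> \<le> transport_cost c \<gamma>" by simp
qed

lemma weak_duality:
  fixes \<mu> \<nu> :: "'a::euclidean_space measure"
  assumes "compact \<Omega>" "\<mu> \<in> borel_probs \<Omega>" "\<nu> \<in> borel_probs \<Omega>"
    "continuous_on (\<Omega> \<times> \<Omega>) (\<lambda>(x, y). c x y)" "continuous_on \<Omega> \<phi>"
  shows "dual_value \<Omega> c \<mu> \<nu> \<phi> \<le> min_cost c \<mu> \<nu>"
  unfolding min_cost_def
  using product_in_plans[OF borel_probsD(1) borel_probsD(1), OF assms(2,3)] weak_duality_plan(3)[OF assms]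
  by (intro cINF_greatest) auto

lemma no_duality_gap_AE:
  fixes \<mu> \<nu> :: "'a::euclidean_space measure"
  assumes \<Omega>: "compact \<Omega>" and \<mu>: "\<mu> \<in> borel_probs \<Omega>" and \<nu>: "\<nu> \<in> borel_probs \<Omega>"
    and c: "continuous_on (\<Omega> \<times> \<Omega>) (\<lambda>(x, y). c x y)" and \<phi>: "continuous_on \<Omega> \<phi>"
    and \<gamma>: "\<gamma> \<in> plans \<mu> \<nu>" and eq: "dual_value \<Omega> c \<mu> \<nu> \<phi> = transport_cost c \<gamma>"
  shows "AE z in \<gamma>. snd z \<in> minimizers \<Omega> c \<phi> (fst z)"
proof -
  note wd = weak_duality_plan[OF \<Omega> \<mu> \<nu> c \<phi> \<gamma>]
  note sp = borel_probsD(3)[OF plans_borel_probs[OF \<mu> \<nu> \<gamma>]]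
  have "AE z in \<gamma>. 0 \<le> c (fst z) (snd z) - \<phi> (snd z) - c_transform \<Omega> c \<phi> (fst z)"
  proof (rule AE_I2)
    fix z assume "z \<in> space \<gamma>"
    then have "fst z \<in> \<Omega>" "snd z \<in> \<Omega>" using sp by (simp_all add: mem_Times_iff)
    from c_transform_le[OF \<Omega> c \<phi> this]
    show "0 \<le> c (fst z) (snd z) - \<phi> (snd z) - c_transform \<Omega> c \<phi> (fst z)" by simp
  qed
  moreover have "(\<integral>z. c (fst z) (snd z) - \<phi> (snd z) - c_transform \<Omega> c \<phi> (fst z) \<partial>\<gamma>) = 0"
    using wd(2) eq by linarith
  ultimately have "AE z in \<gamma>. c (fst z) (snd z) - \<phi> (snd z) - c_transform \<Omega> c \<phi> (fst z) = 0"
    using integral_nonneg_eq_0_iff_AE[OF wd(1)] by blast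
  then show ?thesis
  proof (rule AE_mp, intro AE_I2 impI)
    fix z assume "z \<in> space \<gamma>"
      and z: "c (fst z) (snd z) - \<phi> (snd z) - c_transform \<Omega> c \<phi> (fst z) = 0"
    then have mem: "fst z \<in> \<Omega>" "snd z \<in> \<Omega>" using sp by (simp_all add: mem_Times_iff)
    have "c (fst z) (snd z) - \<phi> (snd z) \<le> c (fst z) y - \<phi> y" if "y \<in> \<Omega>" for y
      using c_transform_le[OF \<Omega> c \<phi> mem(1) that] z by simp
    with mem(2) show "snd z \<in> minimizers \<Omega> c \<phi> (fst z)" by (simp add: minimizers_def)
  qed
qed

lemma dual_value_attained:
  fixes \<mu> \<nu> :: "'a::euclidean_space measure"
  assumes \<Omega>: "compact \<Omega>" and \<mu>: "\<mu> \<in> borel_probs \<Omega>" and \<nu>: "\<nu> \<in> borel_probs \<Omega>"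
    and c: "continuous_on (\<Omega> \<times> \<Omega>) (\<lambda>(x, y). c x y)" and \<phi>: "continuous_on \<Omega> \<phi>"
    and \<gamma>: "\<gamma> \<in> plans \<mu> \<nu>" and opt: "AE z in \<gamma>. snd z \<in> minimizers \<Omega> c \<phi> (fst z)"
  shows "dual_value \<Omega> c \<mu> \<nu> \<phi> = transport_cost c \<gamma>"
proof -
  have "AE z in \<gamma>. c (fst z) (snd z) - \<phi> (snd z) - c_transform \<Omega> c \<phi> (fst z) \<le> 0"
    using opt
  proof (rule AE_mp, intro AE_I2 impI)
    fix z assume "snd z \<in> minimizers \<Omega> c \<phi> (fst z)"
    then have "c (fst z) (snd z) - \<phi> (snd z) \<le> c_transform \<Omega> c \<phi> (fst z)"
      by (intro c_transform_ge) (auto simp: minimizers_def)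
    then show "c (fst z) (snd z) - \<phi> (snd z) - c_transform \<Omega> c \<phi> (fst z) \<le> 0" by simp
  qed
  then have "(\<integral>z. - (c (fst z) (snd z) - \<phi> (snd z) - c_transform \<Omega> c \<phi> (fst z)) \<partial>\<gamma>) \<ge> 0"
    by (intro integral_nonneg_AE) auto
  with weak_duality_plan(2,3)[OF \<Omega> \<mu> \<nu> c \<phi> \<gamma>] show ?thesis by (simp only: integral_minus)
qed

section \<open>Almost everywhere uniqueness of minimizers for the quadratic cost\<close>

text \<open>
  Average the translates of \<open>N\<close> by \<open>t *\<^sub>R b\<close> over \<open>t \<in> [0, 1]\<close>. Translation invariance makes this
  average the measure of \<open>N\<close>, and after exchanging the integrals the inner one is the length of a countable
  set.
\<close>

lemma null_set_if_countable_on_lines: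
  fixes N :: "'a::euclidean_space set" and b :: 'a
  assumes N[measurable]: "N \<in> sets borel" and cnt: "\<And>x. countable {t. x + t *\<^sub>R b \<in> N}"
  shows "emeasure lborel N = 0"
proof -
  let ?I = "indicator {0..1} :: real \<Rightarrow> ennreal"
  let ?f = "\<lambda>(t, x). ?I t * indicator N (x + t *\<^sub>R b)"
  have m[measurable]: "?f \<in> borel_measurable (lborel \<Otimes>\<^sub>M lborel)"
    by measurable
  have shift: "(\<integral>\<^sup>+x. indicator N (x + t *\<^sub>R b) \<partial>lborel) = emeasure lborel N" for t
  proof -
    have "emeasure lborel N = (\<integral>\<^sup>+x. indicator N x \<partial>distr lborel borel ((+) (t *\<^sub>R b)))"
      by (simp add: lborel_distr_plus)
    also have "\<dots> = (\<integral>\<^sup>+x. indicator N (x + t *\<^sub>R b) \<partial>lborel)"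
      by (subst nn_integral_distr) (auto simp: add.commute)
    finally show ?thesis by simp
  qed
  have "emeasure lborel N = (\<integral>\<^sup>+t. ?I t * emeasure lborel N \<partial>lborel)"
    by (simp add: nn_integral_multc)
  also have "\<dots> = (\<integral>\<^sup>+t. \<integral>\<^sup>+x. ?f (t, x) \<partial>lborel \<partial>lborel)"
    by (simp add: nn_integral_cmult shift)
  also have "\<dots> = (\<integral>\<^sup>+x. \<integral>\<^sup>+t. ?f (t, x) \<partial>lborel \<partial>lborel)"
    using lborel_pair.Fubini'[OF m] by simp
  also have "\<dots> = (\<integral>\<^sup>+(x::'a). 0 \<partial>lborel)"
  proof (rule nn_integral_cong)
    fix x :: 'a
    have "AE t in lborel. t \<notin> {t. x + t *\<^sub>R b \<in> N}"
      by (rule AE_not_in) (rule countable_imp_null_set_lborel[OF cnt])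
    then have "AE t in lborel. ?f (t, x) = 0"
      by (rule AE_mp) (auto simp: indicator_def)
    then have "(\<integral>\<^sup>+t. ?f (t, x) \<partial>lborel) = (\<integral>\<^sup>+t. 0 \<partial>(lborel :: real measure))" by (rule nn_integral_cong_AE)
    then show "(\<integral>\<^sup>+t. ?f (t, x) \<partial>lborel) = 0" by simp
  qed
  finally show ?thesis by simp
qed

text \<open>
  The quadratic terms cancel: only the mixed inner products of \<open>cost2\<close> survive the exchange of targets.
\<close>

lemma cost2_exchange:
  fixes a a' y y' :: "'a::euclidean_space"
  assumes "cost2 a y + cost2 a' y' \<le> cost2 a y' + cost2 a' y"
  shows "0 \<le> (a' - a) \<bullet> (y' - y)"
  using assms unfolding cost2_def power2_norm_eq_inner
  by (simp add: inner_diff_left inner_diff_right inner_commute field_simps)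

text \<open>
  By \<open>cost2_exchange\<close>, moving \<open>x\<close> in a basis direction \<open>b\<close> can only increase the \<open>b\<close>-coordinates of the
  minimizers. Given \<open>p < q\<close>, each line in direction \<open>b\<close> therefore contains at most one point that has both a
  minimizer with \<open>b\<close>-coordinate at most \<open>p\<close> and one with at least \<open>q\<close>. Two different minimizers
  are separated in this way for some \<open>b\<close> and some rational \<open>p\<close> and \<open>q\<close>.
\<close>

lemma minimizers_cost2_unique_AE:
  fixes \<phi> :: "'a::euclidean_space \<Rightarrow> real"
  assumes \<Omega>: "compact \<Omega>" and \<phi>: "continuous_on \<Omega> \<phi>"
  shows "AE x in lborel. \<forall>y\<in>minimizers \<Omega> cost2 \<phi> x. \<forall>y'\<in>minimizers \<Omega> cost2 \<phi> x. y = y'"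
proof -
  let ?M = "minimizers \<Omega> cost2 \<phi>"
  define N where "N = (\<lambda>(b::'a, p::real, q::real). {x. (\<exists>y\<in>?M x. y \<bullet> b \<le> p) \<and> (\<exists>y\<in>?M x. q \<le> y \<bullet> b)})"
  define G where "G = {(y, x). y \<in> ?M x}"
  \<comment> \<open>Compactness of \<open>\<Omega>\<close> turns the closed graph into closed projections; this makes the sets \<open>N\<close> Borel.\<close>
  have clG: "closed G"
  proof -
    have G: "G = (\<Omega> \<times> UNIV) \<inter> (\<Inter>y'\<in>\<Omega>. (\<Omega> \<times> UNIV) \<inter> (\<lambda>(y, x). cost2 x y - \<phi> y - (cost2 x y' - \<phi> y')) -` {..0})"
      by (auto simp: G_def minimizers_def)
    have cl: "closed (\<Omega> \<times> (UNIV :: 'a set))" by (rule closed_Times[OF compact_imp_closed[OF \<Omega>] closed_UNIV])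
    have ct: "continuous_on (\<Omega> \<times> (UNIV::'a set)) (\<lambda>z. \<phi> (fst z))"
      by (rule continuous_on_compose2[OF \<phi> continuous_on_fst[OF continuous_on_id]]) auto
    show ?thesis unfolding G
      by (intro closed_Int cl closed_INT ballI continuous_closed_preimage)
        (auto simp: case_prod_unfold cost2_def intro!: continuous_intros ct)
  qed
  have clN: "closed (N (b, p, q))" for b p q
  proof -
    have "closed (G \<inter> {z. fst z \<bullet> b \<le> p})" "closed (G \<inter> {z. q \<le> fst z \<bullet> b})"
      by (intro closed_Int clG closed_Collect_le continuous_intros)+
    note cl = this[THEN closed_compact_projection[OF \<Omega>]]
    have "N (b, p, q) = {x. \<exists>y. y \<in> \<Omega> \<and> (y, x) \<in> G \<inter> {z. fst z \<bullet> b \<le> p}} \<inter> {x. \<exists>y. y \<in> \<Omega> \<and> (y, x) \<in> G \<inter> {z. q \<le> fst z \<bullet> b}}"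
      by (auto simp: N_def G_def minimizers_def)
    then show ?thesis using closed_Int[OF cl] by simp
  qed
  have one: "t' \<le> t" if pq: "p < q" and t: "x + t *\<^sub>R b \<in> N (b, p, q)" and t': "x + t' *\<^sub>R b \<in> N (b, p, q)" for x b p q t t'
  proof (rule ccontr)
    assume "\<not> t' \<le> t"
    obtain y where y: "y \<in> ?M (x + t *\<^sub>R b)" "q \<le> y \<bullet> b" using t by (auto simp: N_def)
    obtain y' where y': "y' \<in> ?M (x + t' *\<^sub>R b)" "y' \<bullet> b \<le> p" using t' by (auto simp: N_def)
    have "cost2 (x + t *\<^sub>R b) y - \<phi> y \<le> cost2 (x + t *\<^sub>R b) y' - \<phi> y'"
      "cost2 (x + t' *\<^sub>R b) y' - \<phi> y' \<le> cost2 (x + t' *\<^sub>R b) y - \<phi> y"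
      using y y' by (auto simp: minimizers_def)
    then have "0 \<le> ((x + t' *\<^sub>R b) - (x + t *\<^sub>R b)) \<bullet> (y' - y)" by (intro cost2_exchange) linarith
    also have "\<dots> = (t' - t) * (y' \<bullet> b - y \<bullet> b)" by (simp add: algebra_simps inner_commute)
    finally show False using \<open>\<not> t' \<le> t\<close> y y' pq by (simp add: zero_le_mult_iff)
  qed
  have "AE x in lborel. \<forall>i\<in>{(b, p, q). b \<in> Basis \<and> p \<in> \<rat> \<and> q \<in> \<rat> \<and> p < q}. x \<notin> N i"
  proof (subst AE_ball_countable)
    show "countable {(b::'a, p::real, q). b \<in> Basis \<and> p \<in> \<rat> \<and> q \<in> \<rat> \<and> p < q}"
      by (rule countable_subset[of _ "Basis \<times> \<rat> \<times> \<rat>"]) (auto intro!: countable_SIGMA countable_rat intro: countable_finite)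
    show "\<forall>i\<in>{(b, p, q). b \<in> Basis \<and> p \<in> \<rat> \<and> q \<in> \<rat> \<and> p < q}. AE x in lborel. x \<notin> N i"
    proof clarify
      fix b p q assume "p < (q :: real)"
      have "countable {t. x + t *\<^sub>R b \<in> N (b, p, q)}" for x
      proof (cases "{t. x + t *\<^sub>R b \<in> N (b, p, q)} = {}")
        case False
        then obtain t where "x + t *\<^sub>R b \<in> N (b, p, q)" by auto
        then have "{t. x + t *\<^sub>R b \<in> N (b, p, q)} \<subseteq> {t}"
          using one[OF \<open>p < q\<close>] by (auto intro: antisym)
        then show ?thesis by (rule countable_subset) simp
      qed simp
      then have "emeasure lborel (N (b, p, q)) = 0"
        using clN by (intro null_set_if_countable_on_lines[where b = b]) auto
      then show "AE x in lborel. x \<notin> N (b, p, q)"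
        using clN by (intro AE_not_in) (auto simp: null_sets_def)
    qed
  qed
  then show ?thesis
  proof (rule AE_mp, intro AE_I2 impI ballI)
    fix x y y' assume x: "\<forall>i\<in>{(b, p, q). b \<in> Basis \<and> p \<in> \<rat> \<and> q \<in> \<rat> \<and> p < q}. x \<notin> N i"
      and y: "y \<in> ?M x" and y': "y' \<in> ?M x"
    have le: "w \<bullet> b \<le> v \<bullet> b" if "v \<in> ?M x" "w \<in> ?M x" "b \<in> Basis" for v w b
    proof (rule ccontr)
      assume "\<not> w \<bullet> b \<le> v \<bullet> b"
      then obtain p where p: "p \<in> \<rat>" "v \<bullet> b < p" "p < w \<bullet> b" using Rats_dense_in_real[of "v \<bullet> b" "w \<bullet> b"] by auto
      then obtain q where q: "q \<in> \<rat>" "p < q" "q < w \<bullet> b" using Rats_dense_in_real[of p "w \<bullet> b"] by auto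
      have "\<exists>y\<in>?M x. y \<bullet> b \<le> p" using p by (intro bexI[of _ v] that) simp
      moreover have "\<exists>y\<in>?M x. q \<le> y \<bullet> b" using q by (intro bexI[of _ w] that) simp
      ultimately have "x \<in> N (b, p, q)" by (simp add: N_def)
      with x that p q show False by blast
    qed
    show "y = y'" by (rule euclidean_eqI) (intro antisym le y y')
  qed
qed

section \<open>Supports of optimal plans are cyclically monotone\<close>

lemma open_Int_space_borel_probs:
  assumes "M \<in> borel_probs S" "open U"
  shows "U \<inter> space M \<in> sets M"
proof -
  have "S \<inter> U \<in> sets (restrict_space borel S)"
    unfolding sets_restrict_space by (rule imageI) (simp add: assms(2))
  then show ?thesis by (simp add: borel_probsD[OF assms(1)] Int_commute)
qed

text \<open>
  The complement of the support is a union of countably many basic open sets of measure zero.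
\<close>

lemma AE_in_spt:
  fixes M :: "'a::second_countable_topology measure"
  assumes "M \<in> borel_probs S"
  shows "AE x in M. x \<in> spt M"
proof -
  obtain \<B> :: "'a set set" where \<B>: "countable \<B>" "topological_basis \<B>"
    using ex_countable_basis by auto
  define N where "N = {b \<in> \<B>. emeasure M (b \<inter> space M) = 0}"
  have "AE x in M. \<forall>b\<in>N. x \<notin> b"
  proof (subst AE_ball_countable)
    show "countable N" using \<B>(1) by (simp add: N_def)
    show "\<forall>b\<in>N. AE x in M. x \<notin> b"
    proof
      fix b assume b: "b \<in> N"
      then have "b \<inter> space M \<in> sets M"
        using topological_basis_open[OF \<B>(2)] by (intro open_Int_space_borel_probs[OF assms]) (simp add: N_def)
      with b show "AE x in M. x \<notin> b"
        by (intro AE_I'[of "b \<inter> space M"]) (auto simp: N_def null_sets_def)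
    qed
  qed
  then show ?thesis
  proof (rule AE_mp, intro AE_I2 impI)
    fix x assume x: "x \<in> space M" "\<forall>b\<in>N. x \<notin> b"
    have "emeasure M (U \<inter> space M) > 0" if U: "open U" "x \<in> U" for U
    proof -
      obtain b where b: "b \<in> \<B>" "x \<in> b" "b \<subseteq> U"
        using topological_basisE[OF \<B>(2) U] by metis
      have "U \<inter> space M \<in> sets M"
        by (rule open_Int_space_borel_probs[OF assms U(1)])
      then have "emeasure M (b \<inter> space M) \<le> emeasure M (U \<inter> space M)"
        using b by (intro emeasure_mono) auto
      moreover have "emeasure M (b \<inter> space M) \<noteq> 0" using b x(2) by (auto simp: N_def)
      ultimately show ?thesis by (auto simp: zero_less_iff_neq_zero)
    qed
    with x(1) show "x \<in> spt M" by (auto simp: spt_def)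
  qed
qed

lemma of_nat_mult_ennreal_inverse:
  "n > 0 \<Longrightarrow> of_nat n * (ennreal (1 / real n) * a) = a"
  by (simp add: mult.assoc[symmetric] ennreal_of_nat_eq_real_of_nat ennreal_mult[symmetric])

text \<open>
  Draw a sample of size \<open>n\<close> from \<open>M\<close> and pick one of its entries at random. The sample may be
  permuted first, even by a permutation \<open>K\<close> that depends on the sample itself, because averaging over all
  positions does not see the order. The law of the entry is \<open>M\<close> in any case.
\<close>

lemma distr_random_sample:
  fixes n :: nat
  assumes n: "n > 0" and M: "prob_space M" and f[measurable]: "f \<in> M \<rightarrow>\<^sub>M N"
    and K: "\<And>\<omega>. \<omega> \<in> space (Pi\<^sub>M {..<n} (\<lambda>_. M)) \<Longrightarrow> bij_betw (\<lambda>i. K i \<omega>) {..<n} {..<n}"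
    and fK: "(\<lambda>(i, \<omega>). f (\<omega> (K i \<omega>))) \<in> uniform_count_measure {..<n} \<Otimes>\<^sub>M Pi\<^sub>M {..<n} (\<lambda>_. M) \<rightarrow>\<^sub>M N"
  shows "distr (uniform_count_measure {..<n} \<Otimes>\<^sub>M Pi\<^sub>M {..<n} (\<lambda>_. M)) N (\<lambda>(i, \<omega>). f (\<omega> (K i \<omega>))) = distr M N f"
    (is "distr (?U \<Otimes>\<^sub>M ?P) N ?F = _")
proof (rule measure_eqI)
  interpret U: prob_space ?U using n by (intro prob_space_uniform_count_measure) auto
  interpret P: prob_space ?P by (rule prob_space_PiM) (rule M)
  interpret pair_sigma_finite ?U ?P ..
  fix A assume "A \<in> sets (distr (?U \<Otimes>\<^sub>M ?P) N ?F)"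
  then have A[measurable]: "A \<in> sets N" by simp
  let ?g = "\<lambda>z. indicator A (f z) :: ennreal"
  have comp: "(\<integral>\<^sup>+\<omega>. ?g (\<omega> i) \<partial>?P) = (\<integral>\<^sup>+z. ?g z \<partial>M)" if "i < n" for i
  proof -
    have "(\<integral>\<^sup>+z. ?g z \<partial>distr ?P M (\<lambda>\<omega>. \<omega> i)) = (\<integral>\<^sup>+\<omega>. ?g (\<omega> i) \<partial>?P)"
      using that by (intro nn_integral_distr) auto
    then show ?thesis using distr_PiM_component[of "{..<n}" "\<lambda>_. M" i] M that by simp
  qed
  have "emeasure (distr (?U \<Otimes>\<^sub>M ?P) N ?F) A = (\<integral>\<^sup>+q. indicator A (?F q) \<partial>(?U \<Otimes>\<^sub>M ?P))"
    using fK by (simp flip: nn_integral_indicator add: nn_integral_distr)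
  also have "\<dots> = (\<integral>\<^sup>+\<omega>. \<integral>\<^sup>+i. ?g (\<omega> (K i \<omega>)) \<partial>?U \<partial>?P)"
    using fK by (subst nn_integral_snd[symmetric]) (auto simp: case_prod_unfold)
  also have "\<dots> = (\<integral>\<^sup>+\<omega>. (\<Sum>i<n. ennreal (1 / n) * ?g (\<omega> i)) \<partial>?P)"
  proof (rule nn_integral_cong)
    fix \<omega> assume "\<omega> \<in> space ?P"
    from sum.reindex_bij_betw[OF K[OF this], of "\<lambda>i. ennreal (1 / n) * ?g (\<omega> i)"]
    show "(\<integral>\<^sup>+i. ?g (\<omega> (K i \<omega>)) \<partial>?U) = (\<Sum>i<n. ennreal (1 / n) * ?g (\<omega> i))"
      by (simp add: uniform_count_measure_def nn_integral_point_measure_finite)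
  qed
  also have "\<dots> = (\<Sum>i<n. ennreal (1 / n) * (\<integral>\<^sup>+\<omega>. ?g (\<omega> i) \<partial>?P))"
    by (subst nn_integral_sum) (auto intro!: sum.cong nn_integral_cmult)
  also have "\<dots> = (\<integral>\<^sup>+z. ?g z \<partial>M)"
    using n by (simp add: comp of_nat_mult_ennreal_inverse)
  also have "\<dots> = emeasure (distr M N f) A"
    by (simp flip: nn_integral_indicator add: nn_integral_distr)
  finally show "emeasure (distr (?U \<Otimes>\<^sub>M ?P) N ?F) A = emeasure (distr M N f) A" .
qed simp

text \<open>
  Draw \<open>n\<close> independent pairs from the optimal plan. Whenever re-matching them along \<open>p\<close> lowers the total
  cost, do so; then pick one of the pairs at random. By \<open>distr_random_sample\<close> the result still has the marginals
  \<open>\<mu>\<close> and \<open>\<nu>\<close>, so it cannot be cheaper on average than the plan, and re-matching almost never pays.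
\<close>

lemma optimal_plan_resampling:
  fixes c :: "'a \<Rightarrow> 'b \<Rightarrow> real" and n :: nat
  assumes opt: "optimal_plan c \<mu> \<nu> \<gamma>" and n: "n > 0"
    and cm: "(\<lambda>z. c (fst z) (snd z)) \<in> borel_measurable (\<mu> \<Otimes>\<^sub>M \<nu>)"
    and cb: "\<And>x y. x \<in> space \<mu> \<Longrightarrow> y \<in> space \<nu> \<Longrightarrow> \<bar>c x y\<bar> \<le> C"
    and p: "bij_betw p {..<n} {..<n}"
  shows "AE \<omega> in Pi\<^sub>M {..<n} (\<lambda>_. \<gamma>).
    (\<Sum>i<n. c (fst (\<omega> i)) (snd (\<omega> i))) \<le> (\<Sum>i<n. c (fst (\<omega> i)) (snd (\<omega> (p i))))"
proof -
  have \<gamma>: "\<gamma> \<in> plans \<mu> \<nu>" and le: "\<And>\<gamma>'. \<gamma>' \<in> plans \<mu> \<nu> \<Longrightarrow> transport_cost c \<gamma> \<le> transport_cost c \<gamma>'"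
    using opt by (auto simp: optimal_plan_def is_arg_min_linorder)
  note pl = plansD[OF \<gamma>]
  let ?U = "uniform_count_measure {..<n}" and ?P = "Pi\<^sub>M {..<n} (\<lambda>_. \<gamma>)"
  interpret U: prob_space ?U using n by (intro prob_space_uniform_count_measure) auto
  interpret P: prob_space ?P by (rule prob_space_PiM) (rule pl(1))
  interpret Q: pair_prob_space ?U ?P ..
  have [measurable]: "fst \<in> \<gamma> \<rightarrow>\<^sub>M \<mu>" "snd \<in> \<gamma> \<rightarrow>\<^sub>M \<nu>" by (fact pl)+
  have pn: "p i < n" if "i < n" for i using bij_betwE[OF p] that by auto
  have cm2: "(\<lambda>\<omega>. c (X \<omega>) (Y \<omega>)) \<in> borel_measurable R" if "X \<in> R \<rightarrow>\<^sub>M \<mu>" "Y \<in> R \<rightarrow>\<^sub>M \<nu>" for X Y and R :: "'z measure"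
    using measurable_compose[OF measurable_Pair[OF that] cm] by simp
  define S where "S = (\<lambda>\<omega>. \<Sum>i<n. c (fst (\<omega> i)) (snd (\<omega> i)))"
  define S' where "S' = (\<lambda>\<omega>. \<Sum>i<n. c (fst (\<omega> i)) (snd (\<omega> (p i))))"
  have [measurable]: "S \<in> borel_measurable ?P" "S' \<in> borel_measurable ?P"
    unfolding S_def S'_def by (auto intro!: borel_measurable_sum cm2 simp: pn)
  have comp_sp: "fst (\<omega> i) \<in> space \<mu>" "snd (\<omega> i) \<in> space \<nu>" if "\<omega> \<in> space ?P" "i < n" for \<omega> i
    using that by (auto simp: space_PiM PiE_iff pl(3) mem_Times_iff)
  \<comment> \<open>The sample-dependent permutation: re-match along \<open>p\<close> exactly when this is cheaper.\<close>
  define K where "K = (\<lambda>i \<omega>. if S' \<omega> < S \<omega> then p i else i)"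
  have Kn: "K i \<omega> < n" if "i < n" for i \<omega> using that pn by (auto simp: K_def)
  have Kbij: "bij_betw (\<lambda>i. K i \<omega>) {..<n} {..<n}" for \<omega>
    using p bij_betw_id[of "{..<n}"] by (cases "S' \<omega> < S \<omega>") (simp_all add: K_def id_def)
  have Km: "(\<lambda>\<omega>. f (\<omega> (K i \<omega>))) \<in> ?P \<rightarrow>\<^sub>M N" if [measurable]: "f \<in> \<gamma> \<rightarrow>\<^sub>M N" and i: "i < n" for f i and N :: "'z measure"
  proof -
    have [measurable]: "(\<lambda>\<omega>. f (\<omega> (p i))) \<in> ?P \<rightarrow>\<^sub>M N" "(\<lambda>\<omega>. f (\<omega> i)) \<in> ?P \<rightarrow>\<^sub>M N"
      by (rule measurable_compose[OF _ that(1)], rule measurable_component_singleton, simp add: i pn)+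
    have "(\<lambda>\<omega>. if S' \<omega> < S \<omega> then f (\<omega> (p i)) else f (\<omega> i)) \<in> ?P \<rightarrow>\<^sub>M N"
      by (intro measurable_If) simp_all
    moreover have "(\<lambda>\<omega>. if S' \<omega> < S \<omega> then f (\<omega> (p i)) else f (\<omega> i)) = (\<lambda>\<omega>. f (\<omega> (K i \<omega>)))"
      by (auto simp: K_def)
    ultimately show ?thesis by simp
  qed
  have ctab: "(\<lambda>(i, \<omega>). h i \<omega>) \<in> ?U \<Otimes>\<^sub>M ?P \<rightarrow>\<^sub>M N" if "\<And>i. i < n \<Longrightarrow> h i \<in> ?P \<rightarrow>\<^sub>M N" for h and N :: "'z measure"
  proof -
    have "(\<lambda>(i, \<omega>). h i \<omega>) \<in> count_space {..<n} \<Otimes>\<^sub>M ?P \<rightarrow>\<^sub>M N"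
      using that by (intro measurable_pair_measure_countable1) auto
    then show ?thesis
      using measurable_cong_sets[OF sets_pair_measure_cong[OF sets_uniform_count_measure_count_space refl] refl] by blast
  qed
  let ?X = "\<lambda>(i, \<omega>). fst (\<omega> i)" and ?Y = "\<lambda>(i, \<omega>). snd (\<omega> (K i \<omega>))"
  have X: "?X \<in> ?U \<Otimes>\<^sub>M ?P \<rightarrow>\<^sub>M \<mu>" by (rule ctab) auto
  have Y: "?Y \<in> ?U \<Otimes>\<^sub>M ?P \<rightarrow>\<^sub>M \<nu>" by (rule ctab) (rule Km; simp)
  have XY[measurable]: "(\<lambda>q. (?X q, ?Y q)) \<in> ?U \<Otimes>\<^sub>M ?P \<rightarrow>\<^sub>M \<mu> \<Otimes>\<^sub>M \<nu>"
    by (rule measurable_Pair[OF X Y])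
  define \<gamma>' where "\<gamma>' = distr (?U \<Otimes>\<^sub>M ?P) (\<mu> \<Otimes>\<^sub>M \<nu>) (\<lambda>q. (?X q, ?Y q))"
  have "\<gamma>' \<in> plans \<mu> \<nu>" unfolding \<gamma>'_def
  proof (rule plan_from_coupling[OF Q.P.prob_space_axioms X Y])
    show "distr (?U \<Otimes>\<^sub>M ?P) \<mu> ?X = \<mu>"
      using distr_random_sample[OF n pl(1) pl(6), of "\<lambda>i \<omega>. i"] X pl(4) by (simp add: bij_betw_def)
    show "distr (?U \<Otimes>\<^sub>M ?P) \<nu> ?Y = \<nu>"
      using distr_random_sample[OF n pl(1) pl(7), of K] Y pl(5) Kbij by simp
  qed
  from le[OF this] have le': "transport_cost c \<gamma> \<le> transport_cost c \<gamma>'" .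
  have bnd: "\<bar>\<Sum>i<n. c (fst (\<omega> i)) (snd (\<omega> (q i)))\<bar> \<le> n * C"
    if w: "\<omega> \<in> space ?P" and q: "\<And>i. i < n \<Longrightarrow> q i < n" for \<omega> q
  proof -
    have "\<bar>\<Sum>i<n. c (fst (\<omega> i)) (snd (\<omega> (q i)))\<bar> \<le> (\<Sum>i<n. \<bar>c (fst (\<omega> i)) (snd (\<omega> (q i)))\<bar>)" by (rule sum_abs)
    also have "\<dots> \<le> (\<Sum>i<n. C)"
    proof (rule sum_mono)
      fix i assume "i \<in> {..<n}"
      then show "\<bar>c (fst (\<omega> i)) (snd (\<omega> (q i)))\<bar> \<le> C"
        using q[of i] by (intro cb comp_sp w) auto
    qed
    finally show ?thesis by simp
  qed
  have iS: "integrable ?P S"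
  proof (rule P.integrable_const_bound[of _ "n * C"])
    show "AE \<omega> in ?P. norm (S \<omega>) \<le> n * C" using bnd[of _ "\<lambda>i. i"] by (auto simp: S_def)
  qed simp
  have iS': "integrable ?P S'"
  proof (rule P.integrable_const_bound[of _ "n * C"])
    show "AE \<omega> in ?P. norm (S' \<omega>) \<le> n * C" using bnd[of _ p] pn by (auto simp: S'_def)
  qed simp
  have T1: "transport_cost c \<gamma> = (\<integral>\<omega>. S \<omega> / n \<partial>?P)"
  proof -
    have "(\<integral>\<omega>. c (fst (\<omega> i)) (snd (\<omega> i)) \<partial>?P) = transport_cost c \<gamma>"
      and "integrable ?P (\<lambda>\<omega>. c (fst (\<omega> i)) (snd (\<omega> i)))" if i: "i < n" for i
    proof -
      have [measurable]: "(\<lambda>\<omega>. \<omega> i) \<in> ?P \<rightarrow>\<^sub>M \<gamma>" using i by auto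
      have "(\<integral>z. c (fst z) (snd z) \<partial>distr ?P \<gamma> (\<lambda>\<omega>. \<omega> i)) = (\<integral>\<omega>. c (fst (\<omega> i)) (snd (\<omega> i)) \<partial>?P)"
        by (intro integral_distr cm2) auto
      then show "(\<integral>\<omega>. c (fst (\<omega> i)) (snd (\<omega> i)) \<partial>?P) = transport_cost c \<gamma>"
        using distr_PiM_component[of "{..<n}" "\<lambda>_. \<gamma>" i] pl(1) i by (simp add: transport_cost_def)
      show "integrable ?P (\<lambda>\<omega>. c (fst (\<omega> i)) (snd (\<omega> i)))"
        using i by (intro P.integrable_const_bound[of _ C] cm2 AE_I2) (auto intro!: cb comp_sp)
    qed
    then show ?thesis using n by (simp add: S_def)
  qed
  have T2: "transport_cost c \<gamma>' = (\<integral>\<omega>. min (S \<omega>) (S' \<omega>) / n \<partial>?P)"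
  proof -
    have i: "integrable (?U \<Otimes>\<^sub>M ?P) (\<lambda>(i, \<omega>). c (fst (\<omega> i)) (snd (\<omega> (K i \<omega>))))"
    proof (rule Q.P.integrable_const_bound[of _ C])
      show "AE q in ?U \<Otimes>\<^sub>M ?P. norm (case q of (i, \<omega>) \<Rightarrow> c (fst (\<omega> i)) (snd (\<omega> (K i \<omega>)))) \<le> C"
      proof (rule AE_I2, clarsimp simp: space_pair_measure space_uniform_count_measure)
        fix i \<omega> assume "i < n" "\<omega> \<in> space ?P"
        then show "\<bar>c (fst (\<omega> i)) (snd (\<omega> (K i \<omega>)))\<bar> \<le> C"
          using Kn[of i \<omega>] by (intro cb comp_sp) auto
      qed
      show "(\<lambda>(i, \<omega>). c (fst (\<omega> i)) (snd (\<omega> (K i \<omega>)))) \<in> borel_measurable (?U \<Otimes>\<^sub>M ?P)"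
        using cm2[OF X Y] by (simp add: case_prod_unfold)
    qed
    have "transport_cost c \<gamma>' = (\<integral>q. (case q of (i, \<omega>) \<Rightarrow> c (fst (\<omega> i)) (snd (\<omega> (K i \<omega>)))) \<partial>(?U \<Otimes>\<^sub>M ?P))"
      unfolding transport_cost_def \<gamma>'_def using cm by (subst integral_distr[OF XY]) (auto simp: case_prod_unfold)
    also have "\<dots> = (\<integral>\<omega>. \<integral>i. c (fst (\<omega> i)) (snd (\<omega> (K i \<omega>))) \<partial>?U \<partial>?P)"
      using Q.integral_snd[OF i] by simp
    also have "\<dots> = (\<integral>\<omega>. min (S \<omega>) (S' \<omega>) / n \<partial>?P)"
      by (rule Bochner_Integration.integral_cong) (auto simp: integral_uniform_count_measure K_def S_def S'_def min_def)
    finally show ?thesis .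
  qed
  have "(\<integral>\<omega>. S \<omega> - min (S \<omega>) (S' \<omega>) \<partial>?P) = n * (transport_cost c \<gamma> - transport_cost c \<gamma>')"
    using n iS iS' by (simp add: T1 T2 right_diff_distrib)
  also have "\<dots> \<le> 0" using le' by (simp add: mult_le_0_iff)
  finally have "(\<integral>\<omega>. S \<omega> - min (S \<omega>) (S' \<omega>) \<partial>?P) \<le> 0" .
  moreover have "0 \<le> (\<integral>\<omega>. S \<omega> - min (S \<omega>) (S' \<omega>) \<partial>?P)"
    by (intro integral_nonneg_AE) auto
  ultimately have "(\<integral>\<omega>. S \<omega> - min (S \<omega>) (S' \<omega>) \<partial>?P) = 0" by simp
  then have "AE \<omega> in ?P. S \<omega> - min (S \<omega>) (S' \<omega>) = 0"
    using iS iS' by (subst (asm) integral_nonneg_eq_0_iff_AE) auto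
  then show ?thesis by (rule AE_mp) (auto simp: S_def S'_def min_def split: if_splits)
qed

text \<open>
  Every neighbourhood of a tuple of support points has positive probability under the product measure, so
  it contains tuples that satisfy the almost sure inequality of \<open>optimal_plan_resampling\<close>. Continuity of the
  cost passes the inequality to the limit.
\<close>

lemma spt_optimal_plan_cyclically_monotone:
  fixes c :: "'a::euclidean_space \<Rightarrow> 'a \<Rightarrow> real" and n :: nat
  assumes \<Omega>: "compact \<Omega>" and \<mu>: "\<mu> \<in> borel_probs \<Omega>" and \<nu>: "\<nu> \<in> borel_probs \<Omega>"
    and c: "continuous_on (\<Omega> \<times> \<Omega>) (\<lambda>(x, y). c x y)"
    and opt: "optimal_plan c \<mu> \<nu> \<gamma>"
    and p: "bij_betw p {..<n} {..<n}" and z: "\<And>i. i < n \<Longrightarrow> z i \<in> spt \<gamma>"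
  shows "(\<Sum>i<n. c (fst (z i)) (snd (z i))) \<le> (\<Sum>i<n. c (fst (z i)) (snd (z (p i))))"
proof (cases "n = 0")
  case False
  then have n: "n > 0" by simp
  have \<gamma>: "\<gamma> \<in> plans \<mu> \<nu>" using opt by (simp add: optimal_plan_def is_arg_min_linorder)
  note \<gamma>p = plans_borel_probs[OF \<mu> \<nu> \<gamma>]
  note sp = borel_probsD(3)[OF \<gamma>p]
  let ?P = "Pi\<^sub>M {..<n} (\<lambda>_. \<gamma>)"
  interpret P: product_prob_space "\<lambda>_. \<gamma>" "{..<n}"
    by (simp add: product_prob_space_def product_prob_space_axioms_def product_sigma_finite_def borel_probsD(1)[OF \<gamma>p] prob_space_imp_sigma_finite)
  have cO: "compact (\<Omega> \<times> \<Omega>)" by (intro compact_Times \<Omega>)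
  have uc: "uniformly_continuous_on (\<Omega> \<times> \<Omega>) (\<lambda>(x, y). c x y)"
    by (intro compact_uniformly_continuous c cO)
  obtain C where C: "\<And>w. w \<in> \<Omega> \<times> \<Omega> \<Longrightarrow> norm (case w of (x, y) \<Rightarrow> c x y) \<le> C"
    using compact_imp_bounded[OF compact_continuous_image[OF c cO]] unfolding bounded_iff by auto
  have cm: "(\<lambda>z. c (fst z) (snd z)) \<in> borel_measurable (\<mu> \<Otimes>\<^sub>M \<nu>)"
    using measurable_continuous_on_borel_probs[OF \<gamma>p c] measurable_cong_sets[OF plansD(2)[OF \<gamma>] refl]
    by (auto simp: case_prod_unfold)
  have ae: "AE \<omega> in ?P. (\<Sum>i<n. c (fst (\<omega> i)) (snd (\<omega> i))) \<le> (\<Sum>i<n. c (fst (\<omega> i)) (snd (\<omega> (p i))))"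
    by (rule optimal_plan_resampling[OF opt n cm _ p, of C])
      (use C in \<open>auto simp: borel_probsD(3)[OF \<mu>] borel_probsD(3)[OF \<nu>]\<close>)
  have pn: "p i < n" if "i < n" for i using bij_betwE[OF p] that by auto
  show ?thesis
  proof (rule field_le_epsilon)
    fix e :: real assume e: "e > 0"
    \<comment> \<open>Each of the \<open>2 * n\<close> cost terms may change by \<open>e'\<close>.\<close>
    define e' where "e' = e / (2 * n)"
    have e': "e' > 0" using e n by (simp add: e'_def)
    obtain d where d: "d > 0"
      "\<And>w w'. w \<in> \<Omega> \<times> \<Omega> \<Longrightarrow> w' \<in> \<Omega> \<times> \<Omega> \<Longrightarrow> dist w' w < d \<Longrightarrow> dist (case w' of (x, y) \<Rightarrow> c x y) (case w of (x, y) \<Rightarrow> c x y) < e'"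
      using uc e' unfolding uniformly_continuous_on_def by metis
    define A where "A = (\<lambda>i. ball (z i) (d/2) \<inter> space \<gamma>)"
    have Apos: "emeasure \<gamma> (A i) > 0" if "i < n" for i
      using z[OF that] d(1) by (auto simp: spt_def A_def)
    then have "emeasure ?P (Pi\<^sub>E {..<n} A) \<noteq> 0"
      by (subst P.emeasure_PiM) (force simp: emeasure_neq_0_sets)+
    moreover have "Pi\<^sub>E {..<n} A \<in> sets ?P"
      using calculation emeasure_neq_0_sets by blast
    ultimately obtain \<omega> where w: "\<omega> \<in> Pi\<^sub>E {..<n} A"
      and le: "(\<Sum>i<n. c (fst (\<omega> i)) (snd (\<omega> i))) \<le> (\<Sum>i<n. c (fst (\<omega> i)) (snd (\<omega> (p i))))"
    proof -
      have "\<exists>\<omega>\<in>Pi\<^sub>E {..<n} A. (\<Sum>i<n. c (fst (\<omega> i)) (snd (\<omega> i))) \<le> (\<Sum>i<n. c (fst (\<omega> i)) (snd (\<omega> (p i))))"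
      proof (rule ccontr)
        assume "\<not> ?thesis"
        with ae have "AE \<omega> in ?P. \<omega> \<notin> Pi\<^sub>E {..<n} A" by (auto elim: AE_mp)
        then have "emeasure ?P (Pi\<^sub>E {..<n} A) = 0"
          using \<open>Pi\<^sub>E {..<n} A \<in> sets ?P\<close> by (subst (asm) AE_iff_measurable[OF \<open>Pi\<^sub>E {..<n} A \<in> sets ?P\<close>])
            (auto dest: sets.sets_into_space)
        with \<open>emeasure ?P (Pi\<^sub>E {..<n} A) \<noteq> 0\<close> show False by simp
      qed
      with that show ?thesis by blast
    qed
    have wA: "dist (z i) (\<omega> i) < d/2" "\<omega> i \<in> \<Omega> \<times> \<Omega>" if "i < n" for i
      using w that sp by (auto simp: A_def PiE_iff)
    have zO: "z i \<in> \<Omega> \<times> \<Omega>" if "i < n" for i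
      using z[OF that] sp by (auto simp: spt_def)
    have close: "\<bar>c (fst (\<omega> i)) (snd (\<omega> j)) - c (fst (z i)) (snd (z j))\<bar> < e'" if ij: "i < n" "j < n" for i j
    proof -
      have "dist (fst (\<omega> i), snd (\<omega> j)) (fst (z i), snd (z j)) \<le> dist (fst (\<omega> i)) (fst (z i)) + dist (snd (\<omega> j)) (snd (z j))"
        using sqrt_sum_squares_le_sum[of "dist (fst (\<omega> i)) (fst (z i))" "dist (snd (\<omega> j)) (snd (z j))"]
        by (simp add: dist_Pair_Pair)
      also have "\<dots> \<le> dist (\<omega> i) (z i) + dist (\<omega> j) (z j)"
        by (intro add_mono dist_fst_le dist_snd_le)
      also have "\<dots> < d" using wA[OF ij(1)] wA[OF ij(2)] by (simp add: dist_commute)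
      finally show ?thesis
        using d(2)[of "(fst (z i), snd (z j))" "(fst (\<omega> i), snd (\<omega> j))"] wA ij zO
        by (auto simp: dist_real_def mem_Times_iff)
    qed
    have "(\<Sum>i<n. c (fst (z i)) (snd (z i))) \<le> (\<Sum>i<n. c (fst (\<omega> i)) (snd (\<omega> i)) + e')"
      using close by (intro sum_mono) (smt (verit, best) lessThan_iff)
    also have "\<dots> \<le> (\<Sum>i<n. c (fst (\<omega> i)) (snd (\<omega> (p i)))) + n * e'"
      using le by (simp add: sum.distrib)
    also have "(\<Sum>i<n. c (fst (\<omega> i)) (snd (\<omega> (p i)))) \<le> (\<Sum>i<n. c (fst (z i)) (snd (z (p i))) + e')"
      using close pn by (intro sum_mono) (smt (verit, best) lessThan_iff)
    also have "\<dots> + n * e' = (\<Sum>i<n. c (fst (z i)) (snd (z (p i)))) + e"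
      using n by (simp add: sum.distrib e'_def)
    finally show "(\<Sum>i<n. c (fst (z i)) (snd (z i))) \<le> (\<Sum>i<n. c (fst (z i)) (snd (z (p i)))) + e" by simp
  qed
qed simp

section \<open>Potentials of cyclically monotone sets\<close>

text \<open>
  Rockafellar's construction: \<open>\<phi> y\<close> is the infimum, over all chains in \<open>\<Gamma>\<close> that start at \<open>z0\<close>, of the
  change in cost caused by shifting every target of the chain to the preceding source, with \<open>y\<close> as the target of the last
  source. Cyclical monotonicity and the Lipschitz bound keep the infimum finite, and appending the pair
  \<open>(x, y)\<close> to a chain that competes for \<open>\<phi> y\<close> gives the asserted minimality. Building \<open>\<phi>\<close> in the second
  variable makes it inherit the Lipschitz constant of the cost.
\<close>

lemma cyclically_monotone_potential:
  fixes c :: "'a \<Rightarrow> 'b::metric_space \<Rightarrow> real" and \<Gamma> :: "('a \<times> 'b) set"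
  assumes z0: "z0 \<in> \<Gamma>" "snd z0 \<in> \<Omega>"
    and cyc: "\<And>n z. (\<And>i. i \<le> n \<Longrightarrow> z i \<in> \<Gamma>) \<Longrightarrow>
      (\<Sum>i\<le>n. c (fst (z i)) (snd (z i))) \<le> (\<Sum>i<n. c (fst (z i)) (snd (z (Suc i)))) + c (fst (z n)) (snd (z 0))"
    and lip: "\<And>x y. (x, y) \<in> \<Gamma> \<Longrightarrow> L-lipschitz_on \<Omega> (c x)"
  obtains \<phi> where "L-lipschitz_on \<Omega> \<phi>"
    "\<And>x y y'. (x, y) \<in> \<Gamma> \<Longrightarrow> y \<in> \<Omega> \<Longrightarrow> y' \<in> \<Omega> \<Longrightarrow> c x y - \<phi> y \<le> c x y' - \<phi> y'"
proof -
  define Z where "Z = {(n::nat, z). z 0 = z0 \<and> (\<forall>i\<le>n. z i \<in> \<Gamma>)}"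
  define V where "V = (\<lambda>(n, z) y. (\<Sum>i<n. c (fst (z i)) (snd (z (Suc i)))) - (\<Sum>i\<le>n. c (fst (z i)) (snd (z i))) + c (fst (z n)) y)"
  define \<phi> where "\<phi> = (\<lambda>y. INF w\<in>Z. V w y)"
  have L: "L \<ge> 0" using lip[of "fst z0" "snd z0"] z0 by (auto dest: lipschitz_on_nonneg)
  have ne: "Z \<noteq> {}" using z0 by (auto simp: Z_def intro!: exI[of _ 0] exI[of _ "\<lambda>_. z0"])
  have V_lip: "V w y \<le> V w y' + L * dist y y'" if "w \<in> Z" "y \<in> \<Omega>" "y' \<in> \<Omega>" for w y y'
  proof -
    obtain n z where w: "w = (n, z)" by (cases w)
    have "z n \<in> \<Gamma>" using that w by (auto simp: Z_def)
    then have "L-lipschitz_on \<Omega> (c (fst (z n)))" using lip[of "fst (z n)" "snd (z n)"] by simp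
    from lipschitz_onD[OF this that(2,3)] show ?thesis by (simp add: w V_def dist_real_def)
  qed
  \<comment> \<open>A chain that is closed up at its starting point is a cycle.\<close>
  have V0: "0 \<le> V w (snd z0)" if "w \<in> Z" for w
    using that cyc[of "fst w" "snd w"] by (auto simp: Z_def V_def)
  have bdd: "bdd_below ((\<lambda>w. V w y) ` Z)" if "y \<in> \<Omega>" for y
    using V_lip[OF _ z0(2) that] V0 by (intro bdd_belowI2[of _ "- (L * dist (snd z0) y)"]) (smt (verit))
  have le: "\<phi> y \<le> V w y" if "w \<in> Z" "y \<in> \<Omega>" for w y
    unfolding \<phi>_def using that bdd by (intro cINF_lower)
  have half: "\<phi> y \<le> \<phi> y' + L * dist y y'" if "y \<in> \<Omega>" "y' \<in> \<Omega>" for y y'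
  proof -
    have "\<phi> y - L * dist y y' \<le> \<phi> y'" unfolding \<phi>_def[of ] using ne
    proof (rule cINF_greatest)
      fix w assume "w \<in> Z"
      with le[of w y] V_lip[of w y y'] that show "(INF w\<in>Z. V w y) - L * dist y y' \<le> V w y'"
        by (simp add: \<phi>_def)
    qed
    then show ?thesis by simp
  qed
  show ?thesis
  proof (rule that)
    show "L-lipschitz_on \<Omega> \<phi>"
    proof (rule lipschitz_onI[OF _ L])
      show "dist (\<phi> y) (\<phi> y') \<le> L * dist y y'" if "y \<in> \<Omega>" "y' \<in> \<Omega>" for y y'
        using half[OF that] half[OF that(2,1)] by (simp add: dist_real_def abs_le_iff dist_commute)
    qed
    fix x y y' assume xy: "(x, y) \<in> \<Gamma>" "y \<in> \<Omega>" "y' \<in> \<Omega>"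
    have "\<phi> y' + c x y - c x y' \<le> \<phi> y" unfolding \<phi>_def[THEN fun_cong, of y] using ne
    proof (rule cINF_greatest)
      fix w assume w: "w \<in> Z"
      obtain n z where nz: "w = (n, z)" by (cases w)
      define z' where "z' = z(Suc n := (x, y))"
      have "(Suc n, z') \<in> Z" using w xy by (auto simp: Z_def nz z'_def le_Suc_eq)
      from le[OF this xy(3)] have "\<phi> y' \<le> V (Suc n, z') y'" .
      also have "V (Suc n, z') y' = V w y + c x y' - c x y"
        by (simp add: V_def nz z'_def)
      finally show "\<phi> y' + c x y - c x y' \<le> V w y" by simp
    qed
    then show "c x y - \<phi> y \<le> c x y' - \<phi> y'" by simp
  qed
qed

section \<open>The Huber cost as an infimal convolution\<close>

text \<open>
  Walk from \<open>x\<close> straight towards \<open>y\<close>, over a distance of at most \<open>lam\<close>. The maximum in the denominator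
  avoids a case distinction and makes continuity evident, also at \<open>x = y\<close>.
\<close>

definition huber_step :: "real \<Rightarrow> 'a::real_normed_vector \<Rightarrow> 'a \<Rightarrow> 'a" where
  "huber_step lam x y = x + (lam / max lam (norm (x - y))) *\<^sub>R (y - x)"

lemma huber_step_eq:
  assumes "lam > 0"
  shows "huber_step lam x y = (if norm (x - y) \<le> lam then y
                     else (1 - lam / norm (x - y)) *\<^sub>R x + (lam / norm (x - y)) *\<^sub>R y)"
  using assms by (auto simp: huber_step_def max_def algebra_simps)

lemma huber_step_in:
  assumes "lam > 0" "convex \<Omega>" "x \<in> \<Omega>" "y \<in> \<Omega>"
  shows "huber_step lam x y \<in> \<Omega>"
proof -
  have t: "0 \<le> lam / max lam (norm (x - y))" "lam / max lam (norm (x - y)) \<le> 1"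
    using assms(1) by (auto simp: divide_simps)
  have "huber_step lam x y = (1 - lam / max lam (norm (x - y))) *\<^sub>R x + (lam / max lam (norm (x - y))) *\<^sub>R y"
    by (simp add: huber_step_def algebra_simps)
  with convexD_alt[OF assms(2-4) t] show ?thesis by simp
qed

lemma continuous_on_huber_step:
  fixes S :: "('a::real_normed_vector \<times> 'a) set"
  assumes "lam > 0"
  shows "continuous_on S (\<lambda>z. huber_step lam (fst z) (snd z))"
  unfolding huber_step_def using assms by (intro continuous_intros) (auto simp: max_def)

text \<open>
  Only the triangle inequality for the three distances enters. For short distances the difference of squares
  factors with second factor at most \<open>2 * lam\<close>; for long ones the tangent to \<open>t\<^sup>2 / 2\<close> at \<open>lam\<close> lies below
  the parabola.
\<close>

lemma huber_cost_le_split: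
  fixes x y z :: "'a::real_normed_vector"
  assumes "lam > 0"
  shows "huber_cost lam x y \<le> cost2 x z + lam * dist z y"
proof -
  define a b d where "a = norm (x - z)" and "b = dist z y" and "d = norm (x - y)"
  have nn: "a \<ge> 0" "b \<ge> 0" "d \<ge> 0" by (simp_all add: a_def b_def d_def)
  have tri: "d \<le> a + b" using dist_triangle[of x y z] by (simp add: a_def b_def d_def dist_norm)
  show ?thesis
  proof (cases "d \<le> lam")
    case True
    have "d\<^sup>2 - a\<^sup>2 \<le> 2 * (lam * b)"
    proof (cases "d \<le> a")
      case True
      then have "d\<^sup>2 \<le> a\<^sup>2" using nn by (intro power_mono) auto
      moreover have "0 \<le> lam * b" using assms nn by simp
      ultimately show ?thesis by linarith
    next
      case False
      have "(d - a) * (d + a) \<le> b * (2 * lam)"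
        using False True tri nn by (intro mult_mono) auto
      then show ?thesis by (simp add: power2_eq_square algebra_simps)
    qed
    then show ?thesis using True by (simp add: huber_cost_def cost2_def a_def b_def d_def)
  next
    case False
    have "lam * d \<le> lam * a + lam * b" using tri assms by (simp flip: distrib_left)
    moreover have "lam * a - lam\<^sup>2 / 2 \<le> a\<^sup>2 / 2"
      using zero_le_power2[of "a - lam"] by (simp add: power2_eq_square algebra_simps)
    ultimately show ?thesis using False by (simp add: huber_cost_def cost2_def a_def b_def d_def)
  qed
qed

lemma huber_cost_eq_split:
  fixes x y :: "'a::real_normed_vector"
  assumes "lam > 0"
  shows "huber_cost lam x y = cost2 x (huber_step lam x y) + lam * dist (huber_step lam x y) y"
proof (cases "norm (x - y) \<le> lam")
  case True
  then show ?thesis using assms by (simp add: huber_step_eq huber_cost_def cost2_def)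
next
  case False
  define d where "d = norm (x - y)"
  have d: "d > lam" using False by (simp add: d_def)
  have s: "huber_step lam x y = x + (lam / d) *\<^sub>R (y - x)" using d by (simp add: huber_step_def d_def max_def)
  have 1: "norm (x - huber_step lam x y) = lam"
  proof -
    have "x - huber_step lam x y = (lam / d) *\<^sub>R (x - y)" by (simp add: s algebra_simps)
    then show ?thesis using d assms by (simp flip: d_def)
  qed
  have 2: "dist (huber_step lam x y) y = d - lam"
  proof -
    have "huber_step lam x y - y = (1 - lam / d) *\<^sub>R (x - y)" by (simp add: s algebra_simps)
    then have "dist (huber_step lam x y) y = \<bar>1 - lam / d\<bar> * d" by (simp add: dist_norm flip: d_def)
    also have "\<dots> = d - lam" using d assms by (simp add: field_simps)
    finally show ?thesis .
  qed
  show ?thesis using False unfolding cost2_def 1 2 by (simp add: huber_cost_def d_def power2_eq_square algebra_simps)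
qed

lemma huber_cost_le_cost2: "lam > 0 \<Longrightarrow> huber_cost lam x y \<le> cost2 x y"
  using huber_cost_le_split[of lam x y y] by simp

text \<open>
  Keep the intermediate point that is optimal for \<open>y'\<close> and redirect only the second leg.
\<close>

lemma huber_cost_lipschitz:
  fixes x :: "'a::real_normed_vector"
  assumes "lam > 0"
  shows "lam-lipschitz_on S (huber_cost lam x)"
proof (rule lipschitz_onI)
  have half: "huber_cost lam x y \<le> huber_cost lam x y' + lam * dist y y'" for y y'
  proof -
    let ?s = "huber_step lam x y'"
    have "huber_cost lam x y \<le> cost2 x ?s + lam * dist ?s y" by (rule huber_cost_le_split[OF assms])
    also have "\<dots> \<le> cost2 x ?s + lam * (dist ?s y' + dist y y')"
      using assms dist_triangle2[of ?s y y'] by simp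
    also have "\<dots> = huber_cost lam x y' + lam * dist y y'"
      by (simp add: huber_cost_eq_split[OF assms, of x y'] algebra_simps)
    finally show ?thesis .
  qed
  show "dist (huber_cost lam x y) (huber_cost lam x y') \<le> lam * dist y y'" for y y'
    using half[of y y'] half[of y' y] by (simp add: dist_real_def abs_le_iff dist_commute)
qed (use assms in simp)

lemma continuous_on_costs:
  fixes S :: "('a::real_normed_vector \<times> 'a) set"
  assumes "lam > 0"
  shows "continuous_on S (\<lambda>(x, y). cost2 x y)"
    "continuous_on S (\<lambda>(x, y). lam * dist x y)"
    "continuous_on S (\<lambda>(x, y). huber_cost lam x y)"
proof -
  show c: "continuous_on S (\<lambda>(x, y). cost2 x y)"
    unfolding case_prod_unfold cost2_def by (intro continuous_intros)
  show "continuous_on S (\<lambda>(x, y). lam * dist x y)"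
    unfolding case_prod_unfold by (intro continuous_intros)
  show "continuous_on S (\<lambda>(x, y). huber_cost lam x y)"
    unfolding case_prod_unfold huber_cost_eq_split[OF assms] cost2_def
    by (intro continuous_intros continuous_on_huber_step[OF assms])
qed

section \<open>The regularized problem and Huber transport\<close>

text \<open>
  The \<open>d\<close>-transform \<open>g\<close> of \<open>\<psi>\<close>, where \<open>d = lam * dist\<close>, prices the second leg. Since the Huber
  cost is at most the price of any two legs, the Huber transform of \<open>\<psi>\<close> is at most the quadratic transform of
  \<open>-g\<close>. In the sum of the two dual values the integrals of \<open>g\<close> against \<open>\<rho>\<close> cancel.
\<close>

lemma dual_huber_le:
  fixes \<mu> \<nu> \<rho> :: "'a::euclidean_space measure"
  assumes \<Omega>: "compact \<Omega>" "\<Omega> \<noteq> {}" and lam: "lam > 0"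
    and \<mu>: "\<mu> \<in> borel_probs \<Omega>" and \<nu>: "\<nu> \<in> borel_probs \<Omega>" and \<rho>: "\<rho> \<in> borel_probs \<Omega>"
    and \<psi>: "continuous_on \<Omega> \<psi>"
  shows "dual_value \<Omega> (huber_cost lam) \<mu> \<nu> \<psi> \<le>
    min_cost cost2 \<mu> \<rho> + min_cost (\<lambda>x y. lam * dist x y) \<rho> \<nu>"
proof -
  note cc = continuous_on_costs[OF lam]
  define g where "g = c_transform \<Omega> (\<lambda>x y. lam * dist x y) \<psi>"
  have g: "continuous_on \<Omega> g" unfolding g_def by (rule continuous_on_c_transform[OF \<Omega>(1) cc(2) \<psi>])
  then have g': "continuous_on \<Omega> (\<lambda>z. - g z)" by (intro continuous_intros)
  have le: "c_transform \<Omega> (huber_cost lam) \<psi> x \<le> c_transform \<Omega> cost2 (\<lambda>z. - g z) x" if x: "x \<in> \<Omega>" for x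
  proof (rule c_transform_ge[OF \<Omega>(2)])
    fix z assume z: "z \<in> \<Omega>"
    have "c_transform \<Omega> (huber_cost lam) \<psi> x - cost2 x z \<le> g z" unfolding g_def
    proof (rule c_transform_ge[OF \<Omega>(2)])
      fix y assume "y \<in> \<Omega>"
      from c_transform_le[OF \<Omega>(1) cc(3) \<psi> x this] huber_cost_le_split[OF lam, of x y z]
      show "c_transform \<Omega> (huber_cost lam) \<psi> x - cost2 x z \<le> lam * dist z y - \<psi> y" by simp
    qed
    then show "c_transform \<Omega> (huber_cost lam) \<psi> x \<le> cost2 x z - - g z" by simp
  qed
  have "(\<integral>x. c_transform \<Omega> (huber_cost lam) \<psi> x \<partial>\<mu>) \<le> (\<integral>x. c_transform \<Omega> cost2 (\<lambda>z. - g z) x \<partial>\<mu>)"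
    using le borel_probsD(3)[OF \<mu>]
    by (intro integral_mono integrable_continuous_on_borel_probs[OF \<mu> \<Omega>(1)] continuous_on_c_transform[OF \<Omega>(1)] cc \<psi> g') auto
  moreover have "dual_value \<Omega> cost2 \<mu> \<rho> (\<lambda>z. - g z) \<le> min_cost cost2 \<mu> \<rho>"
    by (rule weak_duality[OF \<Omega>(1) \<mu> \<rho> cc(1) g'])
  moreover have "dual_value \<Omega> (\<lambda>x y. lam * dist x y) \<rho> \<nu> \<psi> \<le> min_cost (\<lambda>x y. lam * dist x y) \<rho> \<nu>"
    by (rule weak_duality[OF \<Omega>(1) \<rho> \<nu> cc(2) \<psi>])
  ultimately show ?thesis by (simp add: dual_value_def g_def)
qed

text \<open>
  Replace \<open>y\<close> by the intermediate point: \<open>\<phi>\<close> drops by no more than the cost of the second leg that is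
  saved.
\<close>

lemma lipschitz_potential_le_c_transform_huber:
  fixes \<phi> :: "'a::euclidean_space \<Rightarrow> real"
  assumes \<Omega>: "compact \<Omega>" "convex \<Omega>" and lam: "lam > 0"
    and \<phi>: "lam-lipschitz_on \<Omega> \<phi>" and x: "x \<in> \<Omega>"
  shows "c_transform \<Omega> cost2 \<phi> x \<le> c_transform \<Omega> (huber_cost lam) \<phi> x"
proof (rule c_transform_ge)
  show "\<Omega> \<noteq> {}" using x by auto
  fix y assume y: "y \<in> \<Omega>"
  let ?z = "huber_step lam x y"
  have z: "?z \<in> \<Omega>" by (rule huber_step_in[OF lam \<Omega>(2) x y])
  have "c_transform \<Omega> cost2 \<phi> x \<le> cost2 x ?z - \<phi> ?z"
    by (rule c_transform_le[OF \<Omega>(1) continuous_on_costs(1)[OF lam] lipschitz_on_continuous_on[OF \<phi>] x z])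
  also have "\<dots> \<le> huber_cost lam x y - \<phi> y"
    using lipschitz_onD[OF \<phi> z y] by (simp add: huber_cost_eq_split[OF lam, of x y] dist_real_def)
  finally show "c_transform \<Omega> cost2 \<phi> x \<le> huber_cost lam x y - \<phi> y" .
qed

text \<open>
  The infimum of the admissible constants need not be attained a priori, hence the limit argument.
\<close>

lemma lipschitz_on_of_lip_const:
  assumes "lip_const \<Omega> \<phi> = ereal L" "L \<ge> 0"
  shows "L-lipschitz_on \<Omega> \<phi>"
proof (rule lipschitz_onI)
  fix x y assume xy: "x \<in> \<Omega>" "y \<in> \<Omega>"
  show "dist (\<phi> x) (\<phi> y) \<le> L * dist x y"
  proof (rule field_le_epsilon)
    fix e :: real assume e: "e > 0"
    define r where "r = e / (dist x y + 1)"
    have d: "dist x y + 1 > 0" by (rule add_nonneg_pos) auto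
    have r: "r > 0" using e d by (simp add: r_def)
    have "(INF C\<in>{C. C-lipschitz_on \<Omega> \<phi>}. ereal C) < ereal (L + r)"
      using assms r by (simp add: lip_const_def)
    then obtain C where C: "C-lipschitz_on \<Omega> \<phi>" "C < L + r" by (auto simp: INF_less_iff)
    have "dist (\<phi> x) (\<phi> y) \<le> C * dist x y" by (rule lipschitz_onD[OF C(1) xy])
    also have "\<dots> \<le> (L + r) * dist x y" using C(2) by (intro mult_right_mono) auto
    also have "\<dots> \<le> L * dist x y + r * (dist x y + 1)" using r by (simp add: algebra_simps)
    also have "r * (dist x y + 1) = e" using d by (simp add: r_def)
    finally show "dist (\<phi> x) (\<phi> y) \<le> L * dist x y + e" by simp
  qed
qed (rule assms(2))

lemma optimal_map_AE_unique_minimizer: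
  fixes \<mu> \<rho> :: "'a::euclidean_space measure"
  assumes \<Omega>: "compact \<Omega>" and \<mu>: "\<mu> \<in> borel_probs \<Omega>" and \<rho>: "\<rho> \<in> borel_probs \<Omega>"
    and ac: "absolutely_continuous (restrict_space lborel \<Omega>) \<mu>"
    and T: "optimal_map cost2 \<mu> \<rho> T"
    and \<phi>: "continuous_on \<Omega> \<phi>" and dual: "dual_value \<Omega> cost2 \<mu> \<rho> \<phi> = min_cost cost2 \<mu> \<rho>"
  shows "AE x in \<mu>. minimizers \<Omega> cost2 \<phi> x = {T x}"
proof -
  have [measurable]: "T \<in> \<mu> \<rightarrow>\<^sub>M \<rho>" using T by (simp add: optimal_map_def)
  let ?\<gamma> = "distr \<mu> (\<mu> \<Otimes>\<^sub>M \<rho>) (\<lambda>x. (x, T x))"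
  have c: "continuous_on (\<Omega> \<times> \<Omega>) (\<lambda>(x, y). cost2 x (y::'a))"
    using continuous_on_costs(1)[of 1] by simp
  have nn: "cost2 x y \<ge> 0" for x y :: 'a by (simp add: cost2_def)
  have "optimal_plan cost2 \<mu> \<rho> ?\<gamma>" using T by (simp add: optimal_map_def)
  from optimal_plan_min_cost[of cost2, OF nn this]
  have "AE z in ?\<gamma>. snd z \<in> minimizers \<Omega> cost2 \<phi> (fst z)"
    by (intro no_duality_gap_AE[OF \<Omega> \<mu> \<rho> c \<phi>]) (simp_all add: dual)
  then have min: "AE x in \<mu>. T x \<in> minimizers \<Omega> cost2 \<phi> x"
    by (auto dest: AE_distrD[rotated])
  have "\<Omega> \<in> sets lborel" using \<Omega> by (simp add: borel_compact)
  then have "AE x in restrict_space lborel \<Omega>. \<forall>y\<in>minimizers \<Omega> cost2 \<phi> x. \<forall>y'\<in>minimizers \<Omega> cost2 \<phi> x. y = y'"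
    using minimizers_cost2_unique_AE[OF \<Omega> \<phi>] by (subst AE_restrict_space_iff) auto
  moreover have "sets \<mu> = sets (restrict_space lborel \<Omega>)"
    using borel_probsD(2)[OF \<mu>] by (simp add: sets_restrict_space)
  ultimately have "AE x in \<mu>. \<forall>y\<in>minimizers \<Omega> cost2 \<phi> x. \<forall>y'\<in>minimizers \<Omega> cost2 \<phi> x. y = y'"
    using absolutely_continuous_AE ac by blast
  with min show ?thesis by (auto elim!: AE_mp)
qed

text \<open>
  The law \<open>\<sigma>\<close> of the intermediate point under \<open>\<gamma>\<close> is coupled to both \<open>\<mu>\<close> and \<open>\<nu>\<close> by \<open>\<gamma>\<close> itself, and
  the costs of the two legs add up to the Huber cost.
\<close>

lemma huber_plan_splits:
  fixes \<mu> \<nu> :: "'a::euclidean_space measure"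
  assumes \<Omega>: "compact \<Omega>" "convex \<Omega>" and lam: "lam > 0"
    and \<mu>: "\<mu> \<in> borel_probs \<Omega>" and \<nu>: "\<nu> \<in> borel_probs \<Omega>" and \<gamma>: "\<gamma> \<in> plans \<mu> \<nu>"
  obtains \<sigma> where "\<sigma> \<in> borel_probs \<Omega>"
    "min_cost cost2 \<mu> \<sigma> + min_cost (\<lambda>x y. lam * dist x y) \<sigma> \<nu> \<le> transport_cost (huber_cost lam) \<gamma>"
proof -
  let ?z = "\<lambda>w. huber_step lam (fst w) (snd w)" and ?R = "restrict_space borel \<Omega>"
  note pl = plansD[OF \<gamma>] and \<gamma>p = plans_borel_probs[OF \<mu> \<nu> \<gamma>]
  interpret prob_space \<gamma> by (rule pl(1))
  have [measurable]: "fst \<in> \<gamma> \<rightarrow>\<^sub>M \<mu>" "snd \<in> \<gamma> \<rightarrow>\<^sub>M \<nu>" by (fact pl)+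
  have z: "?z \<in> \<gamma> \<rightarrow>\<^sub>M ?R"
  proof (rule measurable_restrict_space2)
    show "?z \<in> space \<gamma> \<rightarrow> \<Omega>"
      using borel_probsD(3)[OF \<gamma>p] huber_step_in[OF lam \<Omega>(2)] by (simp add: Pi_iff mem_Times_iff)
    show "?z \<in> \<gamma> \<rightarrow>\<^sub>M borel"
      by (rule measurable_continuous_on_borel_probs[OF \<gamma>p continuous_on_huber_step[OF lam]])
  qed
  define \<sigma> where "\<sigma> = distr \<gamma> ?R ?z"
  have \<sigma>: "\<sigma> \<in> borel_probs \<Omega>"
    unfolding \<sigma>_def by (rule borel_probsI) (simp_all add: prob_space_distr[OF z])
  have z\<sigma>[measurable]: "?z \<in> \<gamma> \<rightarrow>\<^sub>M \<sigma>" using z by (simp add: \<sigma>_def)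
  have d: "distr \<gamma> \<sigma> ?z = \<sigma>" unfolding \<sigma>_def by (rule distr_cong) simp_all
  have p1: "distr \<gamma> (\<mu> \<Otimes>\<^sub>M \<sigma>) (\<lambda>w. (fst w, ?z w)) \<in> plans \<mu> \<sigma>"
    by (rule plan_from_coupling[OF pl(1,6) z\<sigma> pl(4) d])
  have p2: "distr \<gamma> (\<sigma> \<Otimes>\<^sub>M \<nu>) (\<lambda>w. (?z w, snd w)) \<in> plans \<sigma> \<nu>"
    by (rule plan_from_coupling[OF pl(1) z\<sigma> pl(7) d pl(5)])
  note cc = continuous_on_costs[OF lam]
  have cost: "transport_cost c (distr \<gamma> (M \<Otimes>\<^sub>M N) (\<lambda>w. (X w, Y w))) = (\<integral>w. c (X w) (Y w) \<partial>\<gamma>)"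
    if "X \<in> \<gamma> \<rightarrow>\<^sub>M M" "Y \<in> \<gamma> \<rightarrow>\<^sub>M N" "M \<in> borel_probs \<Omega>" "N \<in> borel_probs \<Omega>"
      "continuous_on (\<Omega> \<times> \<Omega>) (\<lambda>(x, y). c x y)" for c X Y and M N :: "'a measure"
  proof -
    have "M \<Otimes>\<^sub>M N \<in> borel_probs (\<Omega> \<times> \<Omega>)"
      using that by (intro plans_borel_probs[of M \<Omega> N] product_in_plans borel_probsD(1))
    from measurable_continuous_on_borel_probs[OF this that(5)]
    have "(\<lambda>z. c (fst z) (snd z)) \<in> borel_measurable (M \<Otimes>\<^sub>M N)" by (simp add: case_prod_unfold)
    then show ?thesis
      unfolding transport_cost_def using that(1,2) by (subst integral_distr) (auto intro: measurable_Pair)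
  qed
  have int: "integrable \<gamma> (\<lambda>w. cost2 (fst w) (?z w))" "integrable \<gamma> (\<lambda>w. lam * dist (?z w) (snd w))"
    unfolding cost2_def
    by (intro integrable_continuous_on_borel_probs[OF \<gamma>p compact_Times[OF \<Omega>(1) \<Omega>(1)]] continuous_intros continuous_on_huber_step[OF lam])+
  have "min_cost cost2 \<mu> \<sigma> + min_cost (\<lambda>x y. lam * dist x y) \<sigma> \<nu> \<le>
      (\<integral>w. cost2 (fst w) (?z w) \<partial>\<gamma>) + (\<integral>w. lam * dist (?z w) (snd w) \<partial>\<gamma>)"
    using min_cost_le[OF _ p1, of cost2] min_cost_le[OF _ p2, of "\<lambda>x y. lam * dist x y"] lam
      cost[OF pl(6) z\<sigma> \<mu> \<sigma> cc(1)] cost[OF z\<sigma> pl(7) \<sigma> \<nu> cc(2)] by (simp add: cost2_def)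
  also have "\<dots> = transport_cost (huber_cost lam) \<gamma>"
    using int by (simp add: transport_cost_def huber_cost_eq_split[OF lam])
  finally show ?thesis using \<sigma> by (rule that[rotated])
qed

text \<open>
  Attained strong duality for the Huber cost, with a dual solution that is \<open>lam\<close>-Lipschitz and for which
  the duality gap vanishes on the whole support rather than only almost everywhere.
\<close>

lemma optimal_huber_plan_potential:
  fixes \<mu> \<nu> :: "'a::euclidean_space measure"
  assumes \<Omega>: "compact \<Omega>" and lam: "lam > 0"
    and \<mu>: "\<mu> \<in> borel_probs \<Omega>" and \<nu>: "\<nu> \<in> borel_probs \<Omega>"
    and opt: "optimal_plan (huber_cost lam) \<mu> \<nu> \<gamma>"
  obtains \<phi> where "lam-lipschitz_on \<Omega> \<phi>"
    "\<And>x y. (x, y) \<in> spt \<gamma> \<Longrightarrow> y \<in> minimizers \<Omega> (huber_cost lam) \<phi> x"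
    "dual_value \<Omega> (huber_cost lam) \<mu> \<nu> \<phi> = transport_cost (huber_cost lam) \<gamma>"
proof -
  note cc = continuous_on_costs(3)[OF lam]
  have \<gamma>: "\<gamma> \<in> plans \<mu> \<nu>" using opt by (simp add: optimal_plan_def is_arg_min_linorder)
  note \<gamma>p = plans_borel_probs[OF \<mu> \<nu> \<gamma>]
  have sptO: "snd z \<in> \<Omega>" if "z \<in> spt \<gamma>" for z
    using that borel_probsD(3)[OF \<gamma>p] by (simp add: spt_def mem_Times_iff)
  have ae: "AE z in \<gamma>. z \<in> spt \<gamma>" by (rule AE_in_spt[OF \<gamma>p])
  have "\<exists>z0. z0 \<in> spt \<gamma>"
  proof (rule ccontr)
    assume "\<not> ?thesis"
    then have "z \<notin> spt \<gamma>" for z by blast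
    with ae have "AE z in \<gamma>. False" by simp
    then show False using prob_space.AE_False[OF plansD(1)[OF \<gamma>]] by simp
  qed
  then obtain z0 where z0: "z0 \<in> spt \<gamma>" by auto
  have cyc: "(\<Sum>i\<le>n. huber_cost lam (fst (z i)) (snd (z i))) \<le>
      (\<Sum>i<n. huber_cost lam (fst (z i)) (snd (z (Suc i)))) + huber_cost lam (fst (z n)) (snd (z 0))"
    if z: "\<And>i. i \<le> n \<Longrightarrow> z i \<in> spt \<gamma>" for n z
  proof -
    have p: "bij_betw (\<lambda>i. Suc i mod Suc n) {..<Suc n} {..<Suc n}"
    \<comment> \<open>The inverse of the cyclic shift.\<close>
    proof (rule bij_betw_byWitness[where f' = "\<lambda>i. if i = 0 then n else i - 1"])
      show "\<forall>i\<in>{..<Suc n}. (if Suc i mod Suc n = 0 then n else Suc i mod Suc n - 1) = i"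
        by (auto simp: mod_Suc)
      show "\<forall>i\<in>{..<Suc n}. Suc (if i = 0 then n else i - 1) mod Suc n = i" by auto
    qed auto
    have "(\<Sum>i<Suc n. huber_cost lam (fst (z i)) (snd (z i))) \<le>
        (\<Sum>i<Suc n. huber_cost lam (fst (z i)) (snd (z (Suc i mod Suc n))))"
      by (rule spt_optimal_plan_cyclically_monotone[OF \<Omega> \<mu> \<nu> cc opt p]) (use z in auto)
    also have "\<dots> = (\<Sum>i<n. huber_cost lam (fst (z i)) (snd (z (Suc i)))) + huber_cost lam (fst (z n)) (snd (z 0))"
      by (simp add: sum.lessThan_Suc)
    finally show ?thesis by (simp only: lessThan_Suc_atMost)
  qed
  obtain \<phi> where lip: "lam-lipschitz_on \<Omega> \<phi>"
    and \<phi>: "\<And>x y y'. (x, y) \<in> spt \<gamma> \<Longrightarrow> y \<in> \<Omega> \<Longrightarrow> y' \<in> \<Omega> \<Longrightarrow>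
      huber_cost lam x y - \<phi> y \<le> huber_cost lam x y' - \<phi> y'"
    using cyclically_monotone_potential[where c = "huber_cost lam", OF z0 sptO[OF z0] cyc huber_cost_lipschitz[OF lam]] by metis
  have min: "y \<in> minimizers \<Omega> (huber_cost lam) \<phi> x" if "(x, y) \<in> spt \<gamma>" for x y
    using \<phi>[OF that] sptO[OF that] by (simp add: minimizers_def)
  have "AE z in \<gamma>. snd z \<in> minimizers \<Omega> (huber_cost lam) \<phi> (fst z)"
    using ae by (rule AE_mp) (intro AE_I2 impI min, simp)
  note dual = dual_value_attained[OF \<Omega> \<mu> \<nu> cc lipschitz_on_continuous_on[OF lip] \<gamma> this]
  show ?thesis using lip min dual by (rule that)
qed

text \<open>
  The Lipschitz bound compares the intermediate point with \<open>y\<close>, and \<open>huber_cost_le_cost2\<close> compares the Huber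
  competitors with the quadratic ones.
\<close>

lemma huber_step_minimizer:
  fixes \<phi> :: "'a::euclidean_space \<Rightarrow> real"
  assumes lam: "lam > 0" and \<Omega>: "convex \<Omega>" and \<phi>: "lam-lipschitz_on \<Omega> \<phi>" and x: "x \<in> \<Omega>"
    and y: "y \<in> minimizers \<Omega> (huber_cost lam) \<phi> x"
  shows "huber_step lam x y \<in> minimizers \<Omega> cost2 \<phi> x"
proof -
  have yO: "y \<in> \<Omega>" using y by (simp add: minimizers_def)
  let ?z = "huber_step lam x y"
  have z: "?z \<in> \<Omega>" by (rule huber_step_in[OF lam \<Omega> x yO])
  have "cost2 x ?z - \<phi> ?z \<le> cost2 x y' - \<phi> y'" if y': "y' \<in> \<Omega>" for y'
  proof -
    have "cost2 x ?z - \<phi> ?z \<le> huber_cost lam x y - \<phi> y"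
      using lipschitz_onD[OF \<phi> z yO] by (simp add: huber_cost_eq_split[OF lam, of x y] dist_real_def)
    also have "\<dots> \<le> huber_cost lam x y' - \<phi> y'" using y y' by (simp add: minimizers_def)
    also have "\<dots> \<le> cost2 x y' - \<phi> y'" using huber_cost_le_cost2[OF lam, of x y'] by simp
    finally show ?thesis .
  qed
  with z show ?thesis by (simp add: minimizers_def)
qed

text \<open>
  Splitting \<open>\<gamma>\<close> yields a competitor \<open>\<sigma>\<close> whose value is at most the Huber cost of \<open>\<gamma>\<close>. This cost is the
  Huber dual value of \<open>\<phi>\<close>, which in turn is at most the sum of the quadratic and the \<open>d\<close>-dual values at
  \<open>\<rho>\<close>. Minimality of \<open>\<rho>\<close> closes the circle, so neither of the two weak duality inequalities at \<open>\<rho>\<close> can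
  be strict.
\<close>

lemma huber_potential_optimal_for_minimizer:
  fixes \<mu> \<nu> \<rho> :: "'a::euclidean_space measure"
  assumes \<Omega>: "compact \<Omega>" "convex \<Omega>" "\<Omega> \<noteq> {}" and lam: "lam > 0"
    and \<mu>: "\<mu> \<in> borel_probs \<Omega>" and \<nu>: "\<nu> \<in> borel_probs \<Omega>" and \<rho>: "\<rho> \<in> borel_probs \<Omega>"
    and min: "\<And>\<sigma>. \<sigma> \<in> borel_probs \<Omega> \<Longrightarrow>
      min_cost cost2 \<mu> \<rho> + min_cost (\<lambda>x y. lam * dist x y) \<rho> \<nu> \<le> min_cost cost2 \<mu> \<sigma> + min_cost (\<lambda>x y. lam * dist x y) \<sigma> \<nu>"
    and \<gamma>: "\<gamma> \<in> plans \<mu> \<nu>" and \<phi>: "lam-lipschitz_on \<Omega> \<phi>"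
    and dual: "dual_value \<Omega> (huber_cost lam) \<mu> \<nu> \<phi> = transport_cost (huber_cost lam) \<gamma>"
  shows "dual_value \<Omega> cost2 \<mu> \<rho> \<phi> = min_cost cost2 \<mu> \<rho>"
proof -
  note cc = continuous_on_costs[OF lam] and \<phi>c = lipschitz_on_continuous_on[OF \<phi>]
  let ?d = "\<lambda>x y::'a. lam * dist x y"
  obtain \<sigma> where \<sigma>: "\<sigma> \<in> borel_probs \<Omega>"
    "min_cost cost2 \<mu> \<sigma> + min_cost ?d \<sigma> \<nu> \<le> transport_cost (huber_cost lam) \<gamma>"
    by (rule huber_plan_splits[OF \<Omega>(1,2) lam \<mu> \<nu> \<gamma>])
  have "(\<integral>x. c_transform \<Omega> (huber_cost lam) \<phi> x \<partial>\<mu>) \<le> (\<integral>x. c_transform \<Omega> cost2 \<phi> x \<partial>\<mu>)"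
  proof (intro integral_mono integrable_continuous_on_borel_probs[OF \<mu> \<Omega>(1)] continuous_on_c_transform[OF \<Omega>(1)] cc \<phi>c)
    fix x assume "x \<in> space \<mu>"
    then have x: "x \<in> \<Omega>" using borel_probsD(3)[OF \<mu>] by simp
    show "c_transform \<Omega> (huber_cost lam) \<phi> x \<le> c_transform \<Omega> cost2 \<phi> x"
    proof (rule c_transform_ge[OF \<Omega>(3)])
      fix y assume "y \<in> \<Omega>"
      from c_transform_le[OF \<Omega>(1) cc(3) \<phi>c x this] huber_cost_le_cost2[OF lam, of x y]
      show "c_transform \<Omega> (huber_cost lam) \<phi> x \<le> cost2 x y - \<phi> y" by simp
    qed
  qed
  moreover have "(\<integral>y. - \<phi> y \<partial>\<rho>) \<le> (\<integral>z. c_transform \<Omega> ?d \<phi> z \<partial>\<rho>)"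
  proof (intro integral_mono integrable_continuous_on_borel_probs[OF \<rho> \<Omega>(1)] continuous_on_c_transform[OF \<Omega>(1)] cc \<phi>c continuous_on_minus)
    fix z assume "z \<in> space \<rho>"
    then have z: "z \<in> \<Omega>" using borel_probsD(3)[OF \<rho>] by simp
    show "- \<phi> z \<le> c_transform \<Omega> ?d \<phi> z"
      using lipschitz_onD[OF \<phi> z] by (intro c_transform_ge[OF \<Omega>(3)]) (force simp: dist_real_def abs_le_iff)
  qed
  ultimately show ?thesis
    using weak_duality[OF \<Omega>(1) \<mu> \<rho> cc(1) \<phi>c] weak_duality[OF \<Omega>(1) \<rho> \<nu> cc(2) \<phi>c] min[OF \<sigma>(1)] \<sigma>(2) dual
    by (simp add: dual_value_def)
qed

theorem proposition1p4:
  fixes \<Omega> :: "'a::euclidean_space set"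
    and \<mu> \<nu> \<rho> :: "'a measure"
    and lam :: real
    and T :: "'a \<Rightarrow> 'a"
  assumes "compact \<Omega>" and "convex \<Omega>" and "emeasure lborel (interior \<Omega>) > 0"
    and "\<mu> \<in> borel_probs \<Omega>" and "\<nu> \<in> borel_probs \<Omega>"
    and "absolutely_continuous (restrict_space lborel \<Omega>) \<mu>"
    and "lam > 0"
    and "is_arg_min (\<lambda>\<sigma>. 1/2 * (wasserstein 2 \<mu> \<sigma>)\<^sup>2 + lam * wasserstein 1 \<sigma> \<nu>)
           (\<lambda>\<sigma>. \<sigma> \<in> borel_probs \<Omega>) \<rho>"
    and "optimal_map cost2 \<mu> \<rho> T"
    and "\<nu> \<notin> huber_ball \<Omega> lam \<mu>"
  shows "(\<forall>\<phi>. kantorovich_potential_W2 \<Omega> \<mu> \<rho> \<phi> \<longrightarrow> lip_const \<Omega> \<phi> = ereal lam \<longrightarrow>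
           (\<integral>y. \<phi> y \<partial>\<nu>) - (\<integral>y. \<phi> y \<partial>\<rho>) = lam * wasserstein 1 \<rho> \<nu> \<longrightarrow>
             is_arg_max (dual_value \<Omega> (huber_cost lam) \<mu> \<nu>) (\<lambda>\<psi>. continuous_on \<Omega> \<psi>) \<phi> \<and>
             (AE x\<^sub>0 in \<mu>.
                {x. is_arg_min (\<lambda>x. 1/2 * (norm (x - x\<^sub>0))\<^sup>2 - \<phi> x) (\<lambda>x. x \<in> \<Omega>) x} = {T x\<^sub>0})) \<and>
         (\<forall>\<gamma>\<^sub>0. optimal_plan (huber_cost lam) \<mu> \<nu> \<gamma>\<^sub>0 \<longrightarrow>
           (AE x in \<mu>. \<forall>y. (x, y) \<in> spt \<gamma>\<^sub>0 \<longrightarrow>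
              T x = (if norm (x - y) \<le> lam then y
                     else (1 - lam / norm (x - y)) *\<^sub>R x + (lam / norm (x - y)) *\<^sub>R y)))"
proof -
  note \<Omega> = assms(1,2) and \<mu> = assms(4) and \<nu> = assms(5) and ac = assms(6) and lam = assms(7)
    and T = assms(9)
  have \<rho>: "\<rho> \<in> borel_probs \<Omega>" using assms(8) by (simp add: is_arg_min_def)
  have ne: "\<Omega> \<noteq> {}"
    using prob_space.not_empty[OF borel_probsD(1)[OF \<mu>]] borel_probsD(3)[OF \<mu>] by simp
  note cc = continuous_on_costs[OF lam]
  let ?d = "\<lambda>x y::'a. lam * dist x y"
  have W2: "1/2 * (wasserstein 2 \<mu> \<sigma>)\<^sup>2 = min_cost cost2 \<mu> \<sigma>"
    and W1: "lam * wasserstein 1 \<sigma> \<nu> = min_cost ?d \<sigma> \<nu>" if "\<sigma> \<in> borel_probs \<Omega>" for \<sigma>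
    using wasserstein_2_min_cost[OF borel_probsD(1)[OF \<mu>] borel_probsD(1)[OF that]]
      wasserstein_1_min_cost[OF borel_probsD(1)[OF that] borel_probsD(1)[OF \<nu>] lam] by auto
  have min: "min_cost cost2 \<mu> \<rho> + min_cost ?d \<rho> \<nu> \<le> min_cost cost2 \<mu> \<sigma> + min_cost ?d \<sigma> \<nu>"
    if \<sigma>: "\<sigma> \<in> borel_probs \<Omega>" for \<sigma>
    using assms(8) \<sigma> unfolding is_arg_min_linorder by (metis W1 W2 \<rho>)
  show ?thesis
  proof (intro conjI allI impI)
    fix \<phi> assume pot: "kantorovich_potential_W2 \<Omega> \<mu> \<rho> \<phi>" and lc: "lip_const \<Omega> \<phi> = ereal lam"
      and W1eq: "(\<integral>y. \<phi> y \<partial>\<nu>) - (\<integral>y. \<phi> y \<partial>\<rho>) = lam * wasserstein 1 \<rho> \<nu>"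
    have \<phi>: "continuous_on \<Omega> \<phi>" and dual: "dual_value \<Omega> cost2 \<mu> \<rho> \<phi> = min_cost cost2 \<mu> \<rho>"
      using pot W2[OF \<rho>] by (simp_all add: kantorovich_potential_W2_def)
    have lip: "lam-lipschitz_on \<Omega> \<phi>" using lipschitz_on_of_lip_const[OF lc] lam by simp
    have "(\<integral>x. c_transform \<Omega> cost2 \<phi> x \<partial>\<mu>) \<le> (\<integral>x. c_transform \<Omega> (huber_cost lam) \<phi> x \<partial>\<mu>)"
      using lipschitz_potential_le_c_transform_huber[OF \<Omega> lam lip] borel_probsD(3)[OF \<mu>]
      by (intro integral_mono integrable_continuous_on_borel_probs[OF \<mu> \<Omega>(1)] continuous_on_c_transform[OF \<Omega>(1)] cc \<phi>) auto
    then have "min_cost cost2 \<mu> \<rho> + min_cost ?d \<rho> \<nu> \<le> dual_value \<Omega> (huber_cost lam) \<mu> \<nu> \<phi>"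
      using dual W1eq W1[OF \<rho>] by (simp add: dual_value_def)
    then have "dual_value \<Omega> (huber_cost lam) \<mu> \<nu> \<psi> \<le> dual_value \<Omega> (huber_cost lam) \<mu> \<nu> \<phi>"
      if "continuous_on \<Omega> \<psi>" for \<psi>
      using dual_huber_le[OF \<Omega>(1) ne lam \<mu> \<nu> \<rho> that] by linarith
    then show "is_arg_max (dual_value \<Omega> (huber_cost lam) \<mu> \<nu>) (\<lambda>\<psi>. continuous_on \<Omega> \<psi>) \<phi>"
      using \<phi> by (simp add: is_arg_max_linorder)
    have "{x. is_arg_min (\<lambda>x. 1/2 * (norm (x - x0))\<^sup>2 - \<phi> x) (\<lambda>x. x \<in> \<Omega>) x} = minimizers \<Omega> cost2 \<phi> x0" for x0
      by (auto simp: is_arg_min_linorder minimizers_def cost2_def norm_minus_commute)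
    then show "AE x0 in \<mu>. {x. is_arg_min (\<lambda>x. 1/2 * (norm (x - x0))\<^sup>2 - \<phi> x) (\<lambda>x. x \<in> \<Omega>) x} = {T x0}"
      using optimal_map_AE_unique_minimizer[OF \<Omega>(1) \<mu> \<rho> ac T \<phi> dual] by simp
  next
    fix \<gamma> assume opt: "optimal_plan (huber_cost lam) \<mu> \<nu> \<gamma>"
    then have \<gamma>: "\<gamma> \<in> plans \<mu> \<nu>" by (simp add: optimal_plan_def is_arg_min_linorder)
    obtain \<phi> where lip: "lam-lipschitz_on \<Omega> \<phi>"
      and spt: "\<And>x y. (x, y) \<in> spt \<gamma> \<Longrightarrow> y \<in> minimizers \<Omega> (huber_cost lam) \<phi> x"
      and dual: "dual_value \<Omega> (huber_cost lam) \<mu> \<nu> \<phi> = transport_cost (huber_cost lam) \<gamma>"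
      using optimal_huber_plan_potential[OF \<Omega>(1) lam \<mu> \<nu> opt] by metis
    have "dual_value \<Omega> cost2 \<mu> \<rho> \<phi> = min_cost cost2 \<mu> \<rho>"
      by (rule huber_potential_optimal_for_minimizer[OF \<Omega> ne lam \<mu> \<nu> \<rho> min \<gamma> lip dual])
    from optimal_map_AE_unique_minimizer[OF \<Omega>(1) \<mu> \<rho> ac T lipschitz_on_continuous_on[OF lip] this]
    show "AE x in \<mu>. \<forall>y. (x, y) \<in> spt \<gamma> \<longrightarrow>
        T x = (if norm (x - y) \<le> lam then y
               else (1 - lam / norm (x - y)) *\<^sub>R x + (lam / norm (x - y)) *\<^sub>R y)"
    proof (rule AE_mp, intro AE_I2 impI allI)
      fix x y assume "x \<in> space \<mu>" and T: "minimizers \<Omega> cost2 \<phi> x = {T x}" and xy: "(x, y) \<in> spt \<gamma>"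
      then have "x \<in> \<Omega>" using borel_probsD(3)[OF \<mu>] by simp
      from huber_step_minimizer[OF lam \<Omega>(2) lip this spt[OF xy]]
      have "T x = huber_step lam x y" using T by simp
      then show "T x = (if norm (x - y) \<le> lam then y
               else (1 - lam / norm (x - y)) *\<^sub>R x + (lam / norm (x - y)) *\<^sub>R y)"
        by (simp add: huber_step_eq[OF lam])
    qed
  qed
qed

end
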